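(* Let $X$ be a compact metrizable space, let $f:X\to X$ be an expansive homeomorphism with the specification property, and let $\mu$ be an $f$-invariant Borel probability measure of maximal entropy, that is, $h_\mu(f)=h(f)$. Let $d$ be a hyperbolic metric on $X$ for $f$, and let $\Lambda>1$ be the Lipschitz constant of $f$ with respect to $d$. Then, for each $q>1$, $$\frac{h(f)}{\log\Lambda}\le D^-_\mu(q),$$ where $D^-_\mu(q)$ is computed with respect to $d$.
   Context: $h_\mu(f)$ is the metric entropy of $(f,\mu)$ and $h(f)$ is the topological entropy of $f$. A homeomorphism $f$ of a metrizable space $X$ is expansive if, for a metric $\rho$ inducing the topology of $X$, there is $\delta>0$ such that for each pair of different points $x,y\in X$ there is $n\in\mathbb{Z}$ with $\rho(f^n(x),f^n(y))>\delta$. Specification property (Bowen): for each $\eta>0$ there is an integer $N(\eta)$ such that for any $m\ge1$, any points $x_1,\dots,x_m\in X$, any integers $a_1\le b_1<a_2\le b_2<\dots<a_m\le b_m$ with $a_{i+1}-b_i\ge N(\eta)$ for $1\le i<m$, and any integer $p\ge b_m-a_1+N(\eta)$, there is $x\in X$ with $f^p(x)=x$ and $\rho(f^j(x),f^j(x_i))<\eta$ for all $a_i\le j\le b_i$, $1\le i\le m$. Hyperbolic metric: a metric $d$ compatible with the topology of $X$ such that there are numbers $k>1$ and $\varepsilon>0$ with $$\max\{d(f(x),f(y)),d(f^{-1}(x),f^{-1}(y))\}\ge\min\{k\,d(x,y),\varepsilon\}\quad\text{for all }x,y\in X,$$ and such that both $f$ and $f^{-1}$ are Lipschitz for $d$.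 (By a theorem of Fathi, every expansive homeomorphism of a compact metrizable space admits such a metric.) Lower generalized fractal dimension: for $q\ne1$, $D^-_\mu(q)=\liminf_{r\downarrow0}\frac{\log\int_{\operatorname{supp}(\mu)}\mu(B(x,r))^{q-1}d\mu(x)}{(q-1)\log r}$, where $B(x,r)$ is the open $d$-ball of radius $r$ centered at $x$ and $\operatorname{supp}(\mu)$ is the topological support of $\mu$. *)

theory Defs
  imports "HOL-Analysis.Analysis" "HOL-Probability.Probability"
begin

text \<open>
  The space \<open>X\<close> is the universe of a type of class \<^class>\<open>topological_space\<close>; metrics on it are
  explicit functions, so that expansiveness, specification and topological entropy depend on the
  topology only. All logarithms are natural.
\<close>

definition compatible_metric :: "('a::topological_space \<Rightarrow> 'a \<Rightarrow> real) \<Rightarrow> bool" where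
  "compatible_metric d \<longleftrightarrow>
     Metric_space UNIV d \<and> Metric_space.mtopology UNIV d = (euclidean :: 'a topology)"

definition int_iterate :: "('a \<Rightarrow> 'a) \<Rightarrow> int \<Rightarrow> 'a \<Rightarrow> 'a" where
  "int_iterate f n = (if 0 \<le> n then f ^^ nat n else inv f ^^ nat (- n))"

definition expansive :: "('a::topological_space \<Rightarrow> 'a) \<Rightarrow> bool" where
  "expansive f \<longleftrightarrow> (\<exists>\<rho>. compatible_metric \<rho> \<and>
     (\<exists>\<delta>>0. \<forall>x y. x \<noteq> y \<longrightarrow> (\<exists>n. \<rho> (int_iterate f n x) (int_iterate f n y) > \<delta>)))"

text \<open>On a compact space the next property does not depend on the compatible metric \<open>\<rho>\<close>.\<close>

definition specification_property :: "('a::topological_space \<Rightarrow> 'a) \<Rightarrow> bool" where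
  "specification_property f \<longleftrightarrow> (\<exists>\<rho>. compatible_metric \<rho> \<and>
     (\<forall>\<eta>>0. \<exists>N::int. \<forall>m\<ge>(1::nat). \<forall>x :: nat \<Rightarrow> 'a. \<forall>a b :: nat \<Rightarrow> int. \<forall>p::int.
        (\<forall>i\<in>{1..m}. a i \<le> b i) \<longrightarrow>
        (\<forall>i\<in>{1..<m}. b i < a (Suc i) \<and> a (Suc i) - b i \<ge> N) \<longrightarrow>
        p \<ge> b m - a 1 + N \<longrightarrow>
        (\<exists>z. int_iterate f p z = z \<and>
          (\<forall>i\<in>{1..m}. \<forall>j\<in>{a i..b i}. \<rho> (int_iterate f j z) (int_iterate f j (x i)) < \<eta>))))"

definition is_lipschitz_constant :: "('a \<Rightarrow> 'a \<Rightarrow> real) \<Rightarrow> ('a \<Rightarrow> 'a) \<Rightarrow> real \<Rightarrow> bool" where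
  "is_lipschitz_constant d f L \<longleftrightarrow> 0 \<le> L \<and> (\<forall>x y. d (f x) (f y) \<le> L * d x y)"

definition lipschitz_constant :: "('a \<Rightarrow> 'a \<Rightarrow> real) \<Rightarrow> ('a \<Rightarrow> 'a) \<Rightarrow> real" where
  "lipschitz_constant d f = Inf {L. is_lipschitz_constant d f L}"

definition hyperbolic_metric ::
    "('a::topological_space \<Rightarrow> 'a) \<Rightarrow> ('a \<Rightarrow> 'a \<Rightarrow> real) \<Rightarrow> bool" where
  "hyperbolic_metric f d \<longleftrightarrow>
     compatible_metric d \<and>
     (\<exists>k>1. \<exists>\<epsilon>>0. \<forall>x y.
        max (d (f x) (f y)) (d (inv f x) (inv f y)) \<ge> min (k * d x y) \<epsilon>) \<and>
     (\<exists>L. is_lipschitz_constant d f L) \<and> (\<exists>L. is_lipschitz_constant d (inv f) L)"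

text \<open>
  \<open>dyn_join f \<alpha> n\<close> is the join of \<open>\<alpha>, f\<^sup>-\<^sup>1 \<alpha>, \<dots>, f\<^sup>-\<^sup>(\<^sup>n\<^sup>-\<^sup>1\<^sup>) \<alpha>\<close>, for partitions as well as for
  open covers. It may contain the empty set, which affects neither
  \<open>partition_entropy\<close> nor \<open>min_subcover\<close>.
\<close>

definition dyn_join :: "('a \<Rightarrow> 'a) \<Rightarrow> 'a set set \<Rightarrow> nat \<Rightarrow> 'a set set" where
  "dyn_join f \<alpha> n = {(\<Inter>i<n. (f ^^ i) -` A i) |A. \<forall>i<n. A i \<in> \<alpha>}"

text \<open>
  Kolmogorov--Sinai entropy. By subadditivity the upper limit below is a limit whenever \<open>f\<close>
  preserves \<open>M\<close>; note that \<open>0 * ln 0 = 0\<close>.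
\<close>

definition partition_entropy :: "'a measure \<Rightarrow> 'a set set \<Rightarrow> real" where
  "partition_entropy M \<alpha> = - (\<Sum>A\<in>\<alpha>. measure M A * ln (measure M A))"

definition metric_entropy :: "'a measure \<Rightarrow> ('a \<Rightarrow> 'a) \<Rightarrow> ereal" where
  "metric_entropy M f =
     (SUP \<alpha>\<in>{\<alpha>. finite \<alpha> \<and> \<alpha> \<subseteq> sets M \<and> partition_on (space M) \<alpha>}.
        limsup (\<lambda>n. ereal (partition_entropy M (dyn_join f \<alpha> n) / real n)))"

text \<open>
  Topological entropy of a continuous map of a compact space, after Adler, Konheim and McAndrew.
  Again the upper limit is a limit by subadditivity.
\<close>

definition min_subcover :: "'a set set \<Rightarrow> nat" where
  "min_subcover \<U> = Inf (card ` {\<V>. \<V> \<subseteq> \<U> \<and> finite \<V> \<and> \<Union>\<V> = UNIV})"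

definition topological_entropy :: "('a::topological_space \<Rightarrow> 'a) \<Rightarrow> ereal" where
  "topological_entropy f =
     (SUP \<U>\<in>{\<U>. (\<forall>U\<in>\<U>. open U) \<and> \<Union>\<U> = UNIV}.
        limsup (\<lambda>n. ereal (ln (real (min_subcover (dyn_join f \<U> n))) / real n)))"

definition invariant_borel_prob :: "('a::topological_space \<Rightarrow> 'a) \<Rightarrow> 'a measure \<Rightarrow> bool" where
  "invariant_borel_prob f M \<longleftrightarrow>
     prob_space M \<and> sets M = sets borel \<and> f \<in> M \<rightarrow>\<^sub>M M \<and> distr M M f = M"

definition topological_support :: "'a::topological_space measure \<Rightarrow> 'a set" where
  "topological_support M = {x. \<forall>U. open U \<and> x \<in> U \<longrightarrow> measure M U > 0}"

text \<open>
  On a compact metric space and for a Borel probability measure the integrand below is measurable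
  and bounded on the support, also for \<open>q < 1\<close>, and the integral is positive, so none of the total
  operations falls back on a default value.
\<close>

definition lower_fractal_dim ::
    "('a::topological_space \<Rightarrow> 'a \<Rightarrow> real) \<Rightarrow> 'a measure \<Rightarrow> real \<Rightarrow> ereal" where
  "lower_fractal_dim d M q =
     Liminf (at_right 0) (\<lambda>r. ereal (
       ln (LINT x:topological_support M|M. measure M (Metric_space.mball UNIV d x r) powr (q - 1))
         / ((q - 1) * ln r)))"

end

theory Submission
  imports Defs
begin

text \<open>
  Write \<open>h\<close> for the entropy. It suffices to show \<open>\<mu>(A) \<le> C exp (- h n)\<close> for every Bowen ball
  \<open>A\<close> of order \<open>n\<close>, since a metric ball of radius \<open>\<Lambda>\<^sup>-\<^sup>n \<epsilon> / 2\<close> lies in a Bowen ball of order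
  \<open>n + 1\<close>. This bound is obtained directly, without uniqueness or a construction of the measure
  of maximal entropy. Specification gives spanning sets of cardinality at most \<open>exp (h (m + g))\<close>
  for all \<open>m\<close>, with \<open>g\<close> fixed. Cut orbits of length \<open>K n\<close> into \<open>K\<close> blocks and weigh them by
  recording the visits to \<open>A\<close> as Bernoulli trials with success probability \<open>t\<close> and the stretches
  between visits by spanning sets. By Gibbs' inequality the entropy of \<open>\<mu>\<close> over \<open>K n\<close> steps is at
  most the mean cost of this code, and by invariance visits have mean frequency \<open>p = \<mu>(A)\<close>, so
  \<open>h n \<le> p (h g - ln t) + (1 - p) (h n - ln (1 - t))\<close>.
  Taking \<open>t = p / 2\<close> yields \<open>p \<le> 2 exp (1 + h g - h n)\<close>. Orbits sharing a code set stay
  \<open>\<epsilon>\<close>-close, hence by hyperbolicity very close away from the two ends of the time interval;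
  this lets one code serve for all finite measurable partitions at once.
\<close>

section \<open>Metrics on a compact space\<close>

locale compact_metric =
  fixes d :: "'a::topological_space \<Rightarrow> 'a \<Rightarrow> real"
  assumes compact_UNIV: "compact (UNIV :: 'a set)"
    and compatible: "compatible_metric d"
begin

lemma metric_space: "Metric_space UNIV d"
  using compatible by (simp add: compatible_metric_def)

lemma dist_nonneg [simp]: "0 \<le> d x y"
  by (rule Metric_space.nonneg[OF metric_space])

lemma dist_sym: "d x y = d y x"
  by (rule Metric_space.commute[OF metric_space])

lemma dist_zero_iff [simp]: "d x y = 0 \<longleftrightarrow> x = y"
  by (rule Metric_space.zero[OF metric_space UNIV_I UNIV_I])

lemma dist_self [simp]: "d x x = 0"
  by simp

lemma dist_triangle: "d x z \<le> d x y + d y z"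
  by (rule Metric_space.triangle[OF metric_space UNIV_I UNIV_I UNIV_I])

lemma mball_eq: "Metric_space.mball UNIV d x r = {y. d x y < r}"
  by (simp add: Metric_space.mball_def[OF metric_space])

lemma open_iff_dist: "open S \<longleftrightarrow> (\<forall>x\<in>S. \<exists>r>0. \<forall>y. d x y < r \<longrightarrow> y \<in> S)"
proof -
  have "open S \<longleftrightarrow> openin (Metric_space.mtopology UNIV d) S"
    using compatible unfolding compatible_metric_def by (metis open_openin)
  also have "\<dots> \<longleftrightarrow> (\<forall>x. x \<in> S \<longrightarrow> (\<exists>r>0. {y. d x y < r} \<subseteq> S))"
    by (simp only: Metric_space.openin_mtopology[OF metric_space] mball_eq subset_UNIV simp_thms)
  finally show ?thesis by (simp only: subset_iff Ball_def mem_Collect_eq)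
qed
lemma open_dist_less: "open {y. d x y < r}"
  unfolding open_iff_dist
proof clarify
  fix y assume "d x y < r"
  moreover have "d x z < r" if "d y z < r - d x y" for z
    using dist_triangle[of x z y] that by simp
  ultimately have "r - d x y > 0" "\<forall>z. d y z < r - d x y \<longrightarrow> z \<in> {y. d x y < r}" by auto
  then show "\<exists>r'>0. \<forall>z. d y z < r' \<longrightarrow> z \<in> {y. d x y < r}"
    by (intro exI[of _ "r - d x y"]) simp
qed

text \<open>Halving the radii leaves room for the triangle inequality, and a finite subcover makes
  the smallest radius positive.\<close>

lemma Lebesgue_number:
  assumes "\<And>U. U \<in> \<U> \<Longrightarrow> open U" "\<Union>\<U> = UNIV"
  shows "\<exists>\<delta>>0. \<forall>x. \<exists>U\<in>\<U>. {y. d x y < \<delta>} \<subseteq> U"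
proof -
  have "\<forall>x. \<exists>U r. U \<in> \<U> \<and> r > 0 \<and> (\<forall>y. d x y < 2 * r \<longrightarrow> y \<in> U)"
  proof
    fix x
    obtain U where U: "U \<in> \<U>" "x \<in> U" using assms(2) by blast
    have "\<forall>x\<in>U. \<exists>r>0. \<forall>y. d x y < r \<longrightarrow> y \<in> U"
      using assms(1)[OF U(1)] by (rule iffD1[OF open_iff_dist])
    from bspec[OF this U(2)] obtain r where "r > 0" "\<forall>y. d x y < r \<longrightarrow> y \<in> U" by blast
    with U(1) show "\<exists>U r. U \<in> \<U> \<and> r > 0 \<and> (\<forall>y. d x y < 2 * r \<longrightarrow> y \<in> U)"
      by (intro exI[of _ U] exI[of _ "r/2"]) auto
  qed
  then obtain U r where Ur: "\<And>x. U x \<in> \<U>" "\<And>x. r x > 0" "\<And>x y. d x y < 2 * r x \<Longrightarrow> y \<in> U x"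
    by metis
  have "x \<in> {y. d x y < r x}" for x using Ur(2) by simp
  then have "UNIV \<subseteq> (\<Union>x\<in>UNIV. {y. d x y < r x})" by blast
  then obtain F where F: "finite F" "UNIV \<subseteq> (\<Union>x\<in>F. {y. d x y < r x})"
    by (rule compactE_image[OF compact_UNIV open_dist_less])
  \<comment> \<open>Inserting \<open>1\<close> makes \<open>Min\<close> meaningful without a
    separate check that \<open>F\<close> is nonempty.\<close>
  define \<delta> where "\<delta> = Min (insert 1 (r ` F))"
  have "\<delta> > 0" unfolding \<delta>_def using F(1) Ur(2) by auto
  moreover have "\<exists>U\<in>\<U>. {z. d y z < \<delta>} \<subseteq> U" for y
  proof -
    obtain x where x: "x \<in> F" "d x y < r x" using F(2) by auto
    have "z \<in> U x" if "d y z < \<delta>" for z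
    proof -
      have "\<delta> \<le> r x" unfolding \<delta>_def using x F by auto
      then show "z \<in> U x" using that x dist_triangle[of x z y] Ur(3)[of x z] by simp
    qed
    then show ?thesis using Ur(1)[of x] by blast
  qed
  ultimately show ?thesis by blast
qed

text \<open>Specification is given for some compatible metric \<open>\<rho>\<close>, while all
  estimates use \<open>d\<close>. With a Lebesgue number, taken with respect to
  \<open>\<rho>\<close>, of the cover by \<open>d\<close>-balls of radius \<open>e/2\<close>, two
  \<open>\<rho>\<close>-close points lie in a common \<open>d\<close>-ball.\<close>

lemma uniformly_equivalent:
  assumes \<rho>: "compatible_metric \<rho>" and "e > 0"
  obtains \<eta> where "\<eta> > 0" "\<And>x y. \<rho> x y < \<eta> \<Longrightarrow> d x y < e"
proof -
  interpret r: compact_metric \<rho> by unfold_locales (use \<rho> compact_UNIV in auto)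
  have "x \<in> {y. d x y < e/2}" for x using \<open>e > 0\<close> by simp
  then have "\<Union> (range (\<lambda>x. {y. d x y < e/2})) = UNIV" by blast
  then have "\<exists>\<eta>>0. \<forall>x. \<exists>U\<in>range (\<lambda>x. {y. d x y < e/2}). {y. \<rho> x y < \<eta>} \<subseteq> U"
    by (intro r.Lebesgue_number) (auto simp del: less_divide_eq_numeral1 intro!: open_dist_less)
  then obtain \<eta> where \<eta>: "\<eta> > 0" "\<And>x. \<exists>c. {y. \<rho> x y < \<eta>} \<subseteq> {y. d c y < e/2}"
    by auto
  have "d x y < e" if "\<rho> x y < \<eta>" for x y
  proof -
    obtain c where c: "{y. \<rho> x y < \<eta>} \<subseteq> {y. d c y < e/2}" using \<eta>(2)[of x] by blast
    have "x \<in> {y. \<rho> x y < \<eta>}" "y \<in> {y. \<rho> x y < \<eta>}"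
      using r.dist_zero_iff[of x x] \<eta>(1) that by auto
    with c have "d c x < e/2" "d c y < e/2" by blast+
    with dist_triangle[of x y c] show "d x y < e" by (simp add: dist_sym)
  qed
  with \<eta>(1) that show ?thesis by blast
qed

section \<open>Regularity of finite Borel measures\<close>

lemma closed_neighbourhoods:
  assumes "closed F"
  shows "open {y. \<exists>x\<in>F. d x y < r}"
proof -
  have "{y. \<exists>x\<in>F. d x y < r} = (\<Union>x\<in>F. {y. d x y < r})" by blast
  then show ?thesis using open_dist_less by auto
qed

text \<open>Continuity from above: a closed set is the intersection of its shrinking
  neighbourhoods.\<close>

lemma measure_closed_neighbourhoods_LIMSEQ:
  assumes M: "finite_measure M" "sets M = sets borel" and F: "closed F"
  shows "(\<lambda>n. measure M {y. \<exists>x\<in>F. d x y < 1 / Suc n}) \<longlonglongrightarrow> measure M F"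
proof -
  interpret finite_measure M by fact
  have "(\<Inter>n. {y. \<exists>x\<in>F. d x y < 1 / Suc n}) = F"
  proof (intro equalityI subsetI)
    fix y assume y: "y \<in> (\<Inter>n. {y. \<exists>x\<in>F. d x y < 1 / Suc n})"
    show "y \<in> F"
    proof (rule ccontr)
      assume "y \<notin> F"
      with F obtain r where r: "r > 0" "\<forall>z. d y z < r \<longrightarrow> z \<in> - F"
        using open_iff_dist[of "- F"] by (auto simp: closed_def)
      obtain n where "1 / real (Suc n) < r" using r(1) nat_approx_posE by blast
      moreover obtain x where "x \<in> F" "d x y < 1 / Suc n" using y by auto
      ultimately show False using r(2) by (auto simp: dist_sym)
    qed
  next
    fix y assume "y \<in> F"
    then show "y \<in> (\<Inter>n. {y. \<exists>x\<in>F. d x y < 1 / Suc n})" by (auto intro!: bexI[of _ y])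
  qed
  moreover have "(\<lambda>n. measure M {y. \<exists>x\<in>F. d x y < 1 / Suc n}) \<longlonglongrightarrow>
      measure M (\<Inter>n. {y. \<exists>x\<in>F. d x y < 1 / Suc n})"
  proof (rule finite_Lim_measure_decseq)
    show "range (\<lambda>n. {y. \<exists>x\<in>F. d x y < 1 / real (Suc n)}) \<subseteq> sets M"
      using closed_neighbourhoods[OF F] M by auto
    show "decseq (\<lambda>n. {y. \<exists>x\<in>F. d x y < 1 / real (Suc n)})"
    proof (intro decseq_SucI Collect_mono impI)
      fix n y assume "\<exists>x\<in>F. d x y < 1 / real (Suc (Suc n))"
      moreover have "1 / real (Suc (Suc n)) \<le> 1 / real (Suc n)" by (simp add: field_simps)
      ultimately show "\<exists>x\<in>F. d x y < 1 / real (Suc n)" by (meson order.strict_trans2)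
    qed
  qed
  ultimately show ?thesis by simp
qed

text \<open>The sets with this property form a sigma-algebra, and it contains the closed sets, which
  generate the Borel sets. Used to shrink the atoms of a partition to closed sets and to see that
  the support has full measure.\<close>

lemma closed_open_approximation:
  fixes A :: "'a set"
  assumes M: "finite_measure M" "sets M = sets borel" and A: "A \<in> sets borel"
  shows "\<forall>e>0. \<exists>F U. closed F \<and> open U \<and> F \<subseteq> A \<and> A \<subseteq> U \<and> measure M (U - F) < e"
proof -
  interpret finite_measure M by fact
  have [measurable]: "closed S \<Longrightarrow> S \<in> sets M" "open S \<Longrightarrow> S \<in> sets M" for S using M(2) by auto
  have "A \<in> sigma_sets UNIV (Collect closed)"
    using A by (metis borel_eq_closed sets_measure_of subset_UNIV Pow_UNIV)
  then show ?thesis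
  proof induction
    case (Basic F)
    then have F: "closed F" by simp
    show ?case
    proof (intro allI impI)
      fix e :: real assume "e > 0"
      let ?U = "\<lambda>n. {y. \<exists>x\<in>F. d x y < 1 / real (Suc n)}"
      have "eventually (\<lambda>n. measure M (?U n) < measure M F + e) sequentially"
        by (rule order_tendstoD(2)[OF measure_closed_neighbourhoods_LIMSEQ[OF M F]]) (use \<open>e > 0\<close> in simp)
      then obtain n where n: "measure M (?U n) < measure M F + e"
        by (auto simp: eventually_sequentially)
      have sub: "F \<subseteq> ?U n" by (auto intro!: bexI)
      have "measure M (?U n - F) = measure M (?U n) - measure M F"
        by (rule finite_measure_Diff) (use sub F closed_neighbourhoods in auto)
      with n show "\<exists>F' U. closed F' \<and> open U \<and> F' \<subseteq> F \<and> F \<subseteq> U \<and> measure M (U - F') < e"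
        using F sub closed_neighbourhoods[OF F]
        by (intro exI[of _ F] exI[of _ "?U n"]) auto
    qed
  next
    case Empty
    then show ?case by (auto intro!: exI[of _ "{}"])
  next
    case (Compl A)
    show ?case
    proof (intro allI impI)
      fix e :: real assume "e > 0"
      with Compl obtain F U where "closed F" "open U" "F \<subseteq> A" "A \<subseteq> U" "measure M (U - F) < e"
        by metis
      moreover have "(- F) - (- U) = U - F" by blast
      ultimately show "\<exists>F U. closed F \<and> open U \<and> F \<subseteq> UNIV - A \<and> UNIV - A \<subseteq> U \<and> measure M (U - F) < e"
        by (intro exI[of _ "- U"] exI[of _ "- F"]) auto
    qed
  next
    case (Union A)
    show ?case
    proof (intro allI impI)
      fix e :: real assume e: "e > 0"
      \<comment> \<open>These errors add up to \<open>e/2\<close>. The other half pays for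
        truncating the union of the sets \<open>F i\<close>, since a countable union of closed sets
        need not be closed.\<close>
      have "\<forall>i. \<exists>F U. closed F \<and> open U \<and> F \<subseteq> A i \<and> A i \<subseteq> U \<and> measure M (U - F) < e / 2 * (1/2)^Suc i"
        by (intro allI Union.IH[rule_format]) (use e in simp)
      then obtain F U where FU: "\<And>i. closed (F i)" "\<And>i. open (U i)" "\<And>i. F i \<subseteq> A i" "\<And>i. A i \<subseteq> U i"
          "\<And>i. measure M (U i - F i) < e / 2 * (1/2)^Suc i" by metis
      define V where "V = (\<Union>i. U i)"
      have "(\<lambda>n. measure M (\<Union>i\<le>n. F i)) \<longlonglongrightarrow> measure M (\<Union>n. \<Union>i\<le>n. F i)"
      proof (rule finite_Lim_measure_incseq)
        show "range (\<lambda>n. \<Union>i\<le>n. F i) \<subseteq> sets M" using FU(1) by auto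
        show "incseq (\<lambda>n. \<Union>i\<le>n. F i)" by (intro incseq_SucI UN_mono) auto
      qed
      moreover have "(\<Union>n. \<Union>i\<le>n. F i) = (\<Union>i. F i)" by auto
      ultimately have "eventually (\<lambda>n. measure M (\<Union>i\<le>n. F i) > measure M (\<Union>i. F i) - e/2) sequentially"
        using e by (intro order_tendstoD(1)) auto
      then obtain n where n: "measure M (\<Union>i\<le>n. F i) > measure M (\<Union>i. F i) - e/2"
        by (auto simp: eventually_sequentially)
      have s: "(\<lambda>i. e/2 * (1/2)^Suc i) sums (e/2)"
        using sums_mult[OF power_half_series, of "e/2"] by simp
      have "measure M (V - (\<Union>i. F i)) \<le> measure M (\<Union>i. U i - F i)"
        unfolding V_def by (rule finite_measure_mono) (use FU in auto)
      also have "\<dots> \<le> (\<Sum>i. measure M (U i - F i))"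
      proof (rule finite_measure_subadditive_countably)
        show "summable (\<lambda>i. measure M (U i - F i))"
          using FU(5) by (intro summable_comparison_test'[OF sums_summable[OF s], of 0])
            (auto simp: less_imp_le)
      qed (use FU in auto)
      also have "\<dots> \<le> (\<Sum>i. e/2 * (1/2)^Suc i)"
        using FU(5) by (intro suminf_le sums_summable[OF s] summable_comparison_test'[OF sums_summable[OF s], of 0])
            (auto simp: less_imp_le)
      also have "\<dots> = e/2" using s by (simp add: sums_iff)
      finally have 1: "measure M (V - (\<Union>i. F i)) \<le> e/2" .
      have sets: "(\<Union>i. F i) \<in> sets M" "V \<in> sets M" "(\<Union>i\<le>n. F i) \<in> sets M"
        unfolding V_def using FU by auto
      have "F i \<subseteq> U i" for i using FU(3,4) by (rule order_trans)
      then have sub: "(\<Union>i. F i) \<subseteq> V" "(\<Union>i\<le>n. F i) \<subseteq> V" unfolding V_def by blast+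
      have "measure M (V - (\<Union>i. F i)) = measure M V - measure M (\<Union>i. F i)"
        by (rule finite_measure_Diff) (use sets sub in auto)
      moreover have "measure M (V - (\<Union>i\<le>n. F i)) = measure M V - measure M (\<Union>i\<le>n. F i)"
        by (rule finite_measure_Diff) (use sets sub in auto)
      ultimately have "measure M (V - (\<Union>i\<le>n. F i)) < e" using 1 n by linarith
      moreover have "closed (\<Union>i\<le>n. F i)" using FU by auto
      moreover have "open V" "(\<Union>i\<le>n. F i) \<subseteq> \<Union>(range A)" "\<Union>(range A) \<subseteq> V"
        using FU unfolding V_def by auto blast+
      ultimately show "\<exists>F U. closed F \<and> open U \<and> F \<subseteq> \<Union>(range A) \<and> \<Union>(range A) \<subseteq> U \<and> measure M (U - F) < e"
        by blast
    qed
  qed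
qed

end

section \<open>Growth of separated sets\<close>

locale compact_homeo = compact_metric d
  for d :: "'a::topological_space \<Rightarrow> 'a \<Rightarrow> real" +
  fixes f :: "'a \<Rightarrow> 'a"
  assumes homeo: "homeomorphism UNIV UNIV f (inv f)"
begin

lemma bij_f: "bij f"
proof (rule bij_betw_byWitness[where f' = "inv f"])
qed (use homeo in \<open>auto simp: homeomorphism_def\<close>)

lemma inv_f_f [simp]: "inv f (f x) = x"
  using homeo by (simp add: homeomorphism_def)

lemma surj_funpow: "surj (f ^^ n)"
  using bij_fn[OF bij_f] bij_is_surj by blast

lemma open_vimage_funpow:
  assumes "open U"
  shows "open ((f ^^ n) -` U)"
proof (induction n)
  case (Suc n)
  have "continuous_on UNIV f" using homeo by (simp add: homeomorphism_def)
  then have "open (f -` ((f ^^ n) -` U))" using Suc by (rule open_vimage[rotated])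
  then show ?case by (simp add: vimage_def funpow_swap1)
qed (use assms in simp)

text \<open>Bowen's separated sets. The bound \<open>e \<le>\<close> is non-strict so as to be the
  exact negation of the strict one in a Bowen ball; hence maximal separated sets are
  spanning.\<close>

definition separated :: "nat \<Rightarrow> real \<Rightarrow> 'a set \<Rightarrow> bool" where
  "separated n e F \<longleftrightarrow>
     (\<forall>x\<in>F. \<forall>y\<in>F. x \<noteq> y \<longrightarrow> (\<exists>i<n. e \<le> d ((f ^^ i) x) ((f ^^ i) y)))"

text \<open>Compactness excludes the default value of \<open>Inf\<close> on an empty set of
  naturals, so that the infimum is a minimum.\<close>

lemma min_subcover_attained:
  assumes "\<forall>U\<in>\<U>. open U" "\<Union>\<U> = UNIV"
  obtains \<V> where "\<V> \<subseteq> dyn_join f \<U> n" "finite \<V>" "\<Union>\<V> = UNIV"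
    "card \<V> = min_subcover (dyn_join f \<U> n)"
proof -
  let ?J = "dyn_join f \<U> n"
  have "open V" if "V \<in> ?J" for V
    using that assms(1) open_vimage_funpow by (auto simp: dyn_join_def)
  moreover have "UNIV \<subseteq> \<Union>?J"
  proof
    fix x
    have "\<forall>i. \<exists>U\<in>\<U>. (f ^^ i) x \<in> U" using assms(2) by blast
    then obtain A where A: "\<And>i. A i \<in> \<U>" "\<And>i. (f ^^ i) x \<in> A i" by metis
    then have "(\<Inter>i<n. (f ^^ i) -` A i) \<in> ?J" unfolding dyn_join_def by blast
    moreover have "x \<in> (\<Inter>i<n. (f ^^ i) -` A i)" using A(2) by simp
    ultimately show "x \<in> \<Union>?J" by blast
  qed
  ultimately obtain \<W> where "\<W> \<subseteq> ?J" "finite \<W>" "UNIV \<subseteq> \<Union>\<W>"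
    using compactE[OF compact_UNIV, of ?J] by metis
  then have "card ` {\<V>. \<V> \<subseteq> ?J \<and> finite \<V> \<and> \<Union>\<V> = UNIV} \<noteq> {}" by blast
  then have "min_subcover ?J \<in> card ` {\<V>. \<V> \<subseteq> ?J \<and> finite \<V> \<and> \<Union>\<V> = UNIV}"
    unfolding min_subcover_def by (rule Inf_nat_def1)
  then show ?thesis using that by auto
qed

lemma ball_cover:
  assumes "e > 0"
  shows "\<forall>U\<in>range (\<lambda>x. {y. d x y < e}). open U" "\<Union>(range (\<lambda>x. {y. d x y < e})) = UNIV"
proof -
  show "\<forall>U\<in>range (\<lambda>x. {y. d x y < e}). open U" by (auto intro: open_dist_less)
  have "x \<in> {y. d x y < e}" for x using assms by simp
  then show "\<Union>(range (\<lambda>x. {y. d x y < e})) = UNIV" by blast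
qed

text \<open>Each member of the join contains at most one point of \<open>F\<close>: two points of it
  are, at each time, in a common ball of radius \<open>e/2\<close>.\<close>

lemma separated_card_le:
  assumes "separated n e F" "e > 0"
  shows "finite F" "card F \<le> min_subcover (dyn_join f (range (\<lambda>x. {y. d x y < e/2})) n)"
proof -
  have "e/2 > 0" using assms by simp
  then obtain \<V> where \<V>: "\<V> \<subseteq> dyn_join f (range (\<lambda>x. {y. d x y < e/2})) n" "finite \<V>" "\<Union>\<V> = UNIV"
    "card \<V> = min_subcover (dyn_join f (range (\<lambda>x. {y. d x y < e/2})) n)"
    using min_subcover_attained[OF ball_cover] by metis
  have "\<forall>x. \<exists>V\<in>\<V>. x \<in> V" using \<V>(3) by blast
  then obtain V where V: "\<And>x. V x \<in> \<V>" "\<And>x. x \<in> V x" by metis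
  have "inj_on V F"
  proof (rule inj_onI, rule ccontr)
    fix x y assume xy: "x \<in> F" "y \<in> F" "V x = V y" "x \<noteq> y"
    then obtain i where i: "i < n" "e \<le> d ((f ^^ i) x) ((f ^^ i) y)"
      using assms(1) unfolding separated_def by blast
    have "V x \<in> dyn_join f (range (\<lambda>x. {y. d x y < e/2})) n" using V(1) \<V>(1) by blast
    then obtain A where A: "V x = (\<Inter>i<n. (f ^^ i) -` A i)" "\<forall>i<n. A i \<in> range (\<lambda>x. {y. d x y < e/2})"
      unfolding dyn_join_def by blast
    then obtain c where c: "A i = {y. d c y < e/2}" using i(1) by blast
    have "x \<in> V x" "y \<in> V x" using V(2)[of x] V(2)[of y] xy(3) by auto
    then have "(f ^^ i) x \<in> A i" "(f ^^ i) y \<in> A i" unfolding A(1) using i(1) by auto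
    then have "d c ((f ^^ i) x) < e/2" "d c ((f ^^ i) y) < e/2" unfolding c by auto
    then show False using i(2) dist_triangle[of "(f ^^ i) x" "(f ^^ i) y" c] dist_sym[of c "(f ^^ i) x"]
      by simp
  qed
  moreover have "V ` F \<subseteq> \<V>" using V(1) by blast
  ultimately show "finite F" "card F \<le> min_subcover (dyn_join f (range (\<lambda>x. {y. d x y < e/2})) n)"
    using \<V>(2,4) card_inj_on_le[of V F \<V>] inj_on_finite[of V F \<V>] by auto
qed

text \<open>The definition of entropy controls only an upper limit, whereas this bound holds for
  every \<open>n\<close>. By specification, any \<open>K\<close> orbit segments starting in
  \<open>F\<close> can be glued with gaps of bounded length, which yields \<open>card F ^ K\<close>
  separated points for time \<open>K * (n + g)\<close>.\<close>

lemma separated_growth: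
  assumes spec_f: "specification_property f" and "e > 0"
  obtains g :: nat where
    "\<And>n F. separated n e F \<Longrightarrow> n \<ge> 1 \<Longrightarrow> F \<noteq> {} \<Longrightarrow>
       ereal (ln (card F) / real (n + g)) \<le> topological_entropy f"
proof -
  define shadowing where "shadowing \<rho> \<eta> N \<longleftrightarrow>
       (\<forall>m\<ge>(1::nat). \<forall>x :: nat \<Rightarrow> 'a. \<forall>a b :: nat \<Rightarrow> int. \<forall>p::int.
        (\<forall>i\<in>{1..m}. a i \<le> b i) \<longrightarrow>
        (\<forall>i\<in>{1..<m}. b i < a (Suc i) \<and> a (Suc i) - b i \<ge> N) \<longrightarrow>
        p \<ge> b m - a 1 + N \<longrightarrow>
        (\<exists>z. int_iterate f p z = z \<and>
          (\<forall>i\<in>{1..m}. \<forall>j\<in>{a i..b i}. \<rho> (int_iterate f j z) (int_iterate f j (x i)) < \<eta>)))"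
    for \<rho> :: "'a \<Rightarrow> 'a \<Rightarrow> real" and \<eta> and N :: int
  obtain \<rho> where \<rho>: "compatible_metric \<rho>" and "\<forall>\<eta>>0. \<exists>N. shadowing \<rho> \<eta> N"
  proof -
    have "\<exists>\<rho>. compatible_metric \<rho> \<and> (\<forall>\<eta>>0. \<exists>N. shadowing \<rho> \<eta> N)"
      using spec_f by (simp only: specification_property_def shadowing_def)
    with that show ?thesis by blast
  qed
  \<comment> \<open>Tracing two orbits with error \<open>e/4\<close> each uses up \<open>e/2\<close>
    of the separation, so the glued orbits remain \<open>e/2\<close>-separated.\<close>
  have e4: "e/4 > 0" using \<open>e > 0\<close> by simp
  obtain \<eta> where \<eta>: "\<eta> > 0" "\<And>x y. \<rho> x y < \<eta> \<Longrightarrow> d x y < e/4"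
    using uniformly_equivalent[OF \<rho> e4] by blast
  obtain N where N: "shadowing \<rho> \<eta> N"
    using \<eta>(1) \<open>\<forall>\<eta>>0. \<exists>N. shadowing \<rho> \<eta> N\<close> by blast
  \<comment> \<open>\<open>N\<close> may be negative; all that matters is that \<open>g\<close> is
    natural and at least \<open>N\<close>.\<close>
  define g where "g = nat N"
  have "ereal (ln (card F) / real (n + g)) \<le> topological_entropy f"
    if sep: "separated n e F" and n: "n \<ge> 1" and F: "F \<noteq> {}" for n F
  proof -
    define L where "L = n + g"
    have L: "L \<ge> 1" using n by (simp add: L_def)
    let ?M = "\<lambda>n. min_subcover (dyn_join f (range (\<lambda>x. {y. d x y < e/2/2})) n)"
    have finF: "finite F" using separated_card_le(1)[OF sep \<open>e > 0\<close>] .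
    have cardF: "card F \<ge> 1" using finF F by (simp add: Suc_leI card_gt_0_iff)
    have shadow: "\<exists>z. \<forall>i<K. \<forall>l<n. d ((f ^^ (l + i * L)) z) ((f ^^ l) (w i)) < e/4" if K: "K \<ge> 1" for K w
    proof -
      \<comment> \<open>Specification compares \<open>z\<close> and \<open>x i\<close> at the same
        absolute time and counts segments from 1. So \<open>x i\<close> has to arrive at
        \<open>w (i - 1)\<close> when its block begins.\<close>
      define x where "x i = inv (f ^^ ((i - 1) * L)) (w (i - 1))" for i
      define a where "a i = int ((i - 1) * L)" for i
      \<comment> \<open>From \<open>b i\<close> to the start of the next block there are
        \<open>g + 1\<close> steps, a positive number and at least \<open>N\<close>.\<close>
      define b where "b i = a i + int n - 1" for i
      have x: "(f ^^ ((i - 1) * L)) (x i) = w (i - 1)" for i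
        unfolding x_def by (rule surj_f_inv_f[OF surj_funpow])
      have "\<forall>i\<in>{1..<K}. b i < a (Suc i) \<and> a (Suc i) - b i \<ge> N"
      proof
        fix i assume i: "i \<in> {1..<K}"
        then have "i * L = (i - 1) * L + L" by (cases i) auto
        then have "a (Suc i) = a i + int L" by (simp add: a_def)
        then show "b i < a (Suc i) \<and> a (Suc i) - b i \<ge> N" by (simp add: b_def L_def g_def)
      qed
      moreover have "\<forall>i\<in>{1..K}. a i \<le> b i" using n by (simp add: b_def)
      ultimately have "\<exists>z. int_iterate f (b K - a 1 + N) z = z \<and>
          (\<forall>i\<in>{1..K}. \<forall>j\<in>{a i..b i}. \<rho> (int_iterate f j z) (int_iterate f j (x i)) < \<eta>)"
        by (intro N[unfolded shadowing_def, THEN spec[of _ K], THEN mp, THEN spec[of _ x],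
          THEN spec[of _ a], THEN spec[of _ b], THEN spec[of _ "b K - a 1 + N"], THEN mp, THEN mp, THEN mp] K) simp_all
      then obtain z where z: "\<And>i j. i \<in> {1..K} \<Longrightarrow> j \<in> {a i..b i} \<Longrightarrow>
          \<rho> (int_iterate f j z) (int_iterate f j (x i)) < \<eta>" by blast
      have "d ((f ^^ (l + i * L)) z) ((f ^^ l) (w i)) < e/4" if "i < K" "l < n" for i l
      proof -
        have *: "Suc i \<in> {1..K}" "int (l + i * L) \<in> {a (Suc i)..b (Suc i)}"
          using that by (auto simp: a_def b_def)
        have "int_iterate f (int (l + i * L)) y = (f ^^ (l + i * L)) y" for y
          unfolding int_iterate_def by (simp only: of_nat_0_le_iff if_True nat_int)
        moreover have "(f ^^ (l + i * L)) (x (Suc i)) = (f ^^ l) (w i)"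
          using x[of "Suc i"] by (simp add: funpow_add)
        ultimately show ?thesis using \<eta>(2)[OF z[OF *]] by simp
      qed
      then show ?thesis by blast
    qed
    have bound: "real K * ln (card F) \<le> ln (?M (K * L))" if K: "K \<ge> 1" for K
    proof -
      define W where "W = PiE {..<K} (\<lambda>_. F)"
      from shadow[OF K] obtain z where z: "\<And>w i l. i < K \<Longrightarrow> l < n \<Longrightarrow>
        d ((f ^^ (l + i * L)) (z w)) ((f ^^ l) (w i)) < e/4" by metis
      have apart: "\<exists>j<K*L. e/2 \<le> d ((f ^^ j) (z w)) ((f ^^ j) (z w'))"
        if w: "w \<in> W" "w' \<in> W" "w \<noteq> w'" for w w'
      proof -
        obtain i where i: "i < K" "w i \<noteq> w' i"
          using w unfolding W_def by (metis PiE_ext lessThan_iff)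
        have "w i \<in> F" "w' i \<in> F" using w i unfolding W_def by auto
        then obtain l where l: "l < n" "e \<le> d ((f ^^ l) (w i)) ((f ^^ l) (w' i))"
          using sep i(2) unfolding separated_def by blast
        let ?j = "l + i * L"
        have "Suc i * L \<le> K * L" using i(1) by (intro mult_right_mono) auto
        then have "?j < K * L" using l(1) by (simp add: L_def)
        moreover have "e/2 \<le> d ((f ^^ ?j) (z w)) ((f ^^ ?j) (z w'))"
          using l(2) z[OF i(1) l(1), of w] z[OF i(1) l(1), of w']
            dist_triangle[of "(f ^^ l) (w i)" "(f ^^ l) (w' i)" "(f ^^ ?j) (z w)"]
            dist_triangle[of "(f ^^ ?j) (z w)" "(f ^^ l) (w' i)" "(f ^^ ?j) (z w')"]
            dist_sym[of "(f ^^ ?j) (z w)" "(f ^^ l) (w i)"]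
          by linarith
        ultimately show ?thesis by blast
      qed
      have inj: "inj_on z W"
      proof (rule inj_onI, rule ccontr)
        fix w w' assume "w \<in> W" "w' \<in> W" "z w = z w'" "w \<noteq> w'"
        then show False using apart[of w w'] \<open>e > 0\<close> by simp
      qed
      have "separated (K * L) (e/2) (z ` W)"
        unfolding separated_def using apart by blast
      then have "card (z ` W) \<le> ?M (K * L)"
        using separated_card_le(2)[of "K * L" "e/2"] \<open>e > 0\<close> by simp
      moreover have "card (z ` W) = card F ^ K"
        using card_image[OF inj] finF by (simp add: W_def card_PiE)
      ultimately have "real (card F) ^ K \<le> real (?M (K * L))"
        by (metis of_nat_le_iff of_nat_power)
      moreover have "real (card F) ^ K > 0" using cardF by simp
      ultimately have "ln (real (card F) ^ K) \<le> ln (real (?M (K * L)))"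
        by (metis ln_le_cancel_iff order_less_le_trans)
      then show ?thesis using cardF by (simp add: ln_realpow)
    qed
    define u where "u n = ereal (ln (real (?M n)) / real n)" for n
    have "ereal (ln (card F) / real L) \<le> u (Suc K * L)" for K
    proof -
      have "ln (card F) / real L = (real (Suc K) * ln (card F)) / (real (Suc K) * real L)"
        by (simp del: of_nat_Suc)
      also have "\<dots> \<le> ln (real (?M (Suc K * L))) / (real (Suc K) * real L)"
        using bound[of "Suc K"] by (intro divide_right_mono) auto
      finally show ?thesis unfolding u_def of_nat_mult by simp
    qed
    \<comment> \<open>The estimate is available only at the times \<open>Suc K * L\<close>, but a
      subsequence suffices for a lower bound on an upper limit.\<close>
    then have "ereal (ln (card F) / real L) \<le> limsup (u \<circ> (\<lambda>K. Suc K * L))"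
      by (intro le_Limsup) auto
    also have "\<dots> \<le> limsup u"
      by (rule limsup_subseq_mono) (use L in \<open>auto simp: strict_mono_def intro: mult_strict_right_mono\<close>)
    also have "\<dots> \<le> topological_entropy f"
      unfolding topological_entropy_def u_def
      by (rule SUP_upper, rule CollectI, intro conjI ball_cover) (use \<open>e > 0\<close> in simp_all)
    finally show ?thesis by (simp add: L_def)
  qed
  then show ?thesis using that by blast
qed

end

section \<open>Weighted codes\<close>

lemma sum_list_concat: "sum_list (concat xss) = sum_list (map sum_list xss)"
  for xss :: "'a::monoid_add list list"
  by (induction xss) simp_all

lemma sum_lessThan_add:
  "(\<Sum>j<l + m. \<phi> j) = (\<Sum>j<l. \<phi> j) + (\<Sum>j<m. \<phi> (l + j))" for \<phi> :: "nat \<Rightarrow> real"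
  by (induction m) (simp_all add: add.assoc)

locale hyperbolic_homeo = compact_homeo d f
  for d :: "'a::topological_space \<Rightarrow> 'a \<Rightarrow> real" and f :: "'a \<Rightarrow> 'a" +
  fixes k \<epsilon> :: real
  assumes k: "k > 1" and \<epsilon>: "\<epsilon> > 0"
    and hyperbolic: "max (d (f x) (f y)) (d (inv f x) (inv f y)) \<ge> min (k * d x y) \<epsilon>"
begin

text \<open>While both neighbouring distances are below \<open>\<epsilon>\<close>, hyperbolicity
  makes the larger of them at least \<open>k\<close> times the present one. The neighbours of a time
  lying \<open>j + 1\<close> steps inside the interval still lie \<open>j\<close> steps inside, so
  every step away from the ends gains a factor \<open>k\<close>.\<close>

lemma contraction:
  assumes close: "\<And>i. i < N \<Longrightarrow> d ((f ^^ i) x) ((f ^^ i) y) < \<epsilon>"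
  shows "j \<le> i \<Longrightarrow> i + j < N \<Longrightarrow> d ((f ^^ i) x) ((f ^^ i) y) \<le> \<epsilon> / k ^ j"
proof (induction j arbitrary: i)
  case 0
  then show ?case using close[of i] by simp
next
  case (Suc j)
  define \<Delta> where "\<Delta> i = d ((f ^^ i) x) ((f ^^ i) y)" for i
  obtain l where i: "i = Suc l" using Suc.prems by (cases i) auto
  have "min (k * \<Delta> i) \<epsilon> \<le> max (\<Delta> (Suc i)) (\<Delta> l)"
    using hyperbolic[of "(f ^^ i) x" "(f ^^ i) y"] by (simp add: \<Delta>_def i)
  moreover have "max (\<Delta> (Suc i)) (\<Delta> l) < \<epsilon>"
    unfolding \<Delta>_def max_less_iff_conj using Suc.prems i by (intro conjI close) auto
  ultimately have "k * \<Delta> i \<le> max (\<Delta> (Suc i)) (\<Delta> l)" by linarith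
  also have "\<dots> \<le> \<epsilon> / k ^ j"
    unfolding \<Delta>_def max.bounded_iff using Suc.prems i by (intro conjI Suc.IH) auto
  finally have "\<Delta> i * k \<le> \<epsilon> / k ^ j" by (simp only: mult.commute)
  moreover have "0 < k" using k by simp
  ultimately have "\<Delta> i \<le> \<epsilon> / k ^ j / k" by (simp only: pos_le_divide_eq)
  then show ?case by (simp add: \<Delta>_def mult.commute)
qed

definition small :: "nat \<Rightarrow> 'a set \<Rightarrow> bool" where
  "small n S \<longleftrightarrow> (\<forall>x\<in>S. \<forall>y\<in>S. \<forall>i<n. d ((f ^^ i) x) ((f ^^ i) y) < \<epsilon>)"

text \<open>
  By Kraft's inequality, weights with sum at most 1 are those of a code in which the set \<open>S\<close> of
  weight \<open>w\<close> has a code word of length \<open>- ln w\<close>; \<open>\<Phi> x\<close> bounds the code length of \<open>x\<close>.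
\<close>

definition code :: "nat \<Rightarrow> 'a set \<Rightarrow> ('a \<Rightarrow> real) \<Rightarrow> ('a set \<times> real) list \<Rightarrow> bool" where
  "code n D \<Phi> C \<longleftrightarrow> (\<forall>c\<in>set C. small n (fst c) \<and> snd c > 0) \<and> sum_list (map snd C) \<le> 1 \<and>
     (\<forall>x\<in>D. \<exists>c\<in>set C. x \<in> fst c \<and> - ln (snd c) \<le> \<Phi> x)"

lemma codeI:
  assumes "\<And>c. c \<in> set C \<Longrightarrow> small n (fst c)" "\<And>c. c \<in> set C \<Longrightarrow> snd c > 0"
    and "sum_list (map snd C) \<le> 1"
    and "\<And>x. x \<in> D \<Longrightarrow> \<exists>c\<in>set C. x \<in> fst c \<and> - ln (snd c) \<le> \<Phi> x"
  shows "code n D \<Phi> C"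
  using assms by (simp add: code_def)

lemma
  assumes "code n D \<Phi> C"
  shows code_small: "c \<in> set C \<Longrightarrow> small n (fst c)"
    and code_pos: "c \<in> set C \<Longrightarrow> snd c > 0"
    and code_sum: "sum_list (map snd C) \<le> 1"
    and code_cover: "x \<in> D \<Longrightarrow> \<exists>c\<in>set C. x \<in> fst c \<and> - ln (snd c) \<le> \<Phi> x"
  using assms by (simp_all add: code_def)

definition coded :: "nat \<Rightarrow> 'a set \<Rightarrow> ('a \<Rightarrow> real) \<Rightarrow> bool" where
  "coded n D \<Phi> \<longleftrightarrow> (\<exists>C. code n D \<Phi> C)"

lemma codedE:
  assumes "coded n D \<Phi>"
  obtains C where "code n D \<Phi> C"
  using assms by (auto simp: coded_def)

lemma coded_mono:
  assumes "coded n D \<Phi>" "n' \<le> n" "D' \<subseteq> D" "\<And>x. x \<in> D' \<Longrightarrow> \<Phi> x \<le> \<Phi>' x"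
  shows "coded n' D' \<Phi>'"
proof -
  obtain C where C: "code n D \<Phi> C" using assms(1) by (rule codedE)
  have "code n' D' \<Phi>' C"
  proof (rule codeI)
    fix c assume "c \<in> set C"
    then show "small n' (fst c)" using code_small[OF C] assms(2) by (simp add: small_def)
  next
    fix x assume x: "x \<in> D'"
    then obtain c where "c \<in> set C" "x \<in> fst c" "- ln (snd c) \<le> \<Phi> x"
      using code_cover[OF C, of x] assms(3) by blast
    then show "\<exists>c\<in>set C. x \<in> fst c \<and> - ln (snd c) \<le> \<Phi>' x"
      using assms(4)[OF x] by (intro bexI[of _ c]) simp_all
  qed (use code_pos[OF C] code_sum[OF C] in auto)
  then show ?thesis by (auto simp: coded_def)
qed

text \<open>The code word first announces \<open>l\<close>, at cost \<open>- ln (t l)\<close>, and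
  then uses the code for \<open>D l\<close>.\<close>

lemma coded_mix:
  assumes I: "finite I" and cod: "\<And>l. l \<in> I \<Longrightarrow> coded n (D l) (\<Psi> l)"
    and t: "\<And>l. l \<in> I \<Longrightarrow> t l > 0" "(\<Sum>l\<in>I. t l) \<le> 1"
    and \<Phi>: "\<And>x. x \<in> E \<Longrightarrow> \<exists>l\<in>I. x \<in> D l \<and> \<Psi> l x - ln (t l) \<le> \<Phi> x"
  shows "coded n E \<Phi>"
proof -
  have "\<forall>l\<in>I. \<exists>C. code n (D l) (\<Psi> l) C" using cod by (simp add: coded_def)
  then obtain C where "\<forall>l\<in>I. code n (D l) (\<Psi> l) (C l)" by (rule bchoice[THEN exE])
  then have C: "code n (D l) (\<Psi> l) (C l)" if "l \<in> I" for l using that by blast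
  obtain ls where ls: "set ls = I" "distinct ls" using I finite_distinct_list by blast
  define B where "B = concat (map (\<lambda>l. map (\<lambda>c. (fst c, t l * snd c)) (C l)) ls)"
  have B: "\<exists>l\<in>I. \<exists>c'\<in>set (C l). c = (fst c', t l * snd c')" if "c \<in> set B" for c
    using that unfolding B_def ls(1)[symmetric] by auto
  have "code n E \<Phi> B"
  proof (rule codeI)
    fix c assume "c \<in> set B"
    then obtain l c' where "l \<in> I" "c' \<in> set (C l)" "c = (fst c', t l * snd c')" using B by blast
    then show "small n (fst c)" "snd c > 0" using code_small[OF C] code_pos[OF C] t(1) by auto
  next
    have "sum_list (map snd B) = (\<Sum>l\<leftarrow>ls. t l * sum_list (map snd (C l)))"
      unfolding B_def by (simp add: map_concat sum_list_concat o_def sum_list_const_mult)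
    also have "\<dots> = (\<Sum>l\<in>I. t l * sum_list (map snd (C l)))"
      using ls by (metis sum_list_distinct_conv_sum_set)
    also have "\<dots> \<le> (\<Sum>l\<in>I. t l * 1)"
      using code_sum[OF C] t(1) by (intro sum_mono mult_left_mono) (auto simp: less_imp_le)
    also have "\<dots> \<le> 1" using t(2) by simp
    finally show "sum_list (map snd B) \<le> 1" .
  next
    fix x assume "x \<in> E"
    then obtain l where l: "l \<in> I" "x \<in> D l" "\<Psi> l x - ln (t l) \<le> \<Phi> x" using \<Phi> by blast
    obtain c where c: "c \<in> set (C l)" "x \<in> fst c" "- ln (snd c) \<le> \<Psi> l x"
      using code_cover[OF C[OF l(1)] l(2)] by blast
    have "(fst c, t l * snd c) \<in> set B" unfolding B_def using l(1) ls(1) c(1) by auto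
    moreover have "ln (t l * snd c) = ln (t l) + ln (snd c)"
      using code_pos[OF C[OF l(1)] c(1)] t(1)[OF l(1)] by (simp add: ln_mult)
    ultimately show "\<exists>c\<in>set B. x \<in> fst c \<and> - ln (snd c) \<le> \<Phi> x"
      using c(2,3) l(3) by (intro bexI[of _ "(fst c, t l * snd c)"]) simp_all
  qed
  then show ?thesis by (auto simp: coded_def)
qed

text \<open>Two successive time intervals are coded one after the other: weights multiply and
  lengths add.\<close>

lemma coded_concat:
  assumes "coded n D \<Phi>" "coded n' D' \<Phi>'"
  shows "coded (n + n') (D \<inter> (f ^^ n) -` D') (\<lambda>x. \<Phi> x + \<Phi>' ((f ^^ n) x))"
proof -
  obtain C where C: "code n D \<Phi> C" using assms(1) by (rule codedE)
  obtain C' where C': "code n' D' \<Phi>' C'" using assms(2) by (rule codedE)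
  \<comment> \<open>Different pairs may produce the same entry. A list counts each occurrence, so
    the total weights multiply exactly.\<close>
  define B where "B = concat (map (\<lambda>c. map (\<lambda>c'. (fst c \<inter> (f ^^ n) -` fst c', snd c * snd c')) C') C)"
  have B: "\<exists>c\<in>set C. \<exists>c'\<in>set C'. b = (fst c \<inter> (f ^^ n) -` fst c', snd c * snd c')" if "b \<in> set B" for b
    using that unfolding B_def by auto
  have "code (n + n') (D \<inter> (f ^^ n) -` D') (\<lambda>x. \<Phi> x + \<Phi>' ((f ^^ n) x)) B"
  proof (rule codeI)
    fix b assume "b \<in> set B"
    then obtain c c' where b: "c \<in> set C" "c' \<in> set C'" "b = (fst c \<inter> (f ^^ n) -` fst c', snd c * snd c')"
      using B by blast
    show "snd b > 0" using code_pos[OF C b(1)] code_pos[OF C' b(2)] b(3) by simp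
    show "small (n + n') (fst b)"
      unfolding small_def
    proof (intro ballI allI impI)
      fix x y i assume xy: "x \<in> fst b" "y \<in> fst b" "i < n + n'"
      show "d ((f ^^ i) x) ((f ^^ i) y) < \<epsilon>"
      proof (cases "i < n")
        case True
        then show ?thesis using code_small[OF C b(1)] xy b(3) by (simp add: small_def)
      next
        case False
        then have i: "i = (i - n) + n" "i - n < n'" using xy(3) by auto
        have "d ((f ^^ (i - n)) ((f ^^ n) x)) ((f ^^ (i - n)) ((f ^^ n) y)) < \<epsilon>"
          using code_small[OF C' b(2)] xy b(3) i(2) by (simp add: small_def)
        then show ?thesis using i(1) by (metis comp_apply funpow_add)
      qed
    qed
  next
    have "sum_list (map snd B) = (\<Sum>c\<leftarrow>C. snd c * sum_list (map snd C'))"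
      unfolding B_def by (simp add: map_concat sum_list_concat o_def sum_list_const_mult)
    also have "\<dots> = sum_list (map snd C) * sum_list (map snd C')" by (simp add: sum_list_mult_const)
    also have "\<dots> \<le> 1 * 1"
      using code_sum[OF C] code_sum[OF C'] code_pos[OF C] code_pos[OF C']
      by (intro mult_mono sum_list_nonneg) (auto intro: less_imp_le)
    finally show "sum_list (map snd B) \<le> 1" by simp
  next
    fix x assume "x \<in> D \<inter> (f ^^ n) -` D'"
    then have x: "x \<in> D" "(f ^^ n) x \<in> D'" by auto
    obtain c where c: "c \<in> set C" "x \<in> fst c" "- ln (snd c) \<le> \<Phi> x"
      using code_cover[OF C x(1)] by blast
    obtain c' where c': "c' \<in> set C'" "(f ^^ n) x \<in> fst c'" "- ln (snd c') \<le> \<Phi>' ((f ^^ n) x)"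
      using code_cover[OF C' x(2)] by blast
    let ?b = "(fst c \<inter> (f ^^ n) -` fst c', snd c * snd c')"
    have "?b \<in> set B" unfolding B_def using c(1) c'(1) by auto
    moreover have "ln (snd c * snd c') = ln (snd c) + ln (snd c')"
      using code_pos[OF C c(1)] code_pos[OF C' c'(1)] by (simp add: ln_mult)
    ultimately show "\<exists>b\<in>set B. x \<in> fst b \<and> - ln (snd b) \<le> \<Phi> x + \<Phi>' ((f ^^ n) x)"
      using c(2,3) c'(2,3) by (intro bexI[of _ ?b]) simp_all
  qed
  then show ?thesis by (auto simp: coded_def)
qed

end

section \<open>Entropy and codes\<close>

text \<open>Relative entropy is nonnegative, by \<open>ln u \<le> u - 1\<close> for the ratio
  \<open>u\<close> of weight to probability. The partition is an indexed family, with
  \<open>\<iota> x\<close> the index of the cell of \<open>x\<close>, because several indices may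
  have empty cells.\<close>

lemma (in prob_space) Gibbs_inequality:
  fixes G :: "'a \<Rightarrow> real"
  assumes J: "finite J" and cyl: "\<And>a. a \<in> J \<Longrightarrow> cyl a \<in> sets M"
    and \<iota>: "\<And>x. x \<in> space M \<Longrightarrow> \<iota> x \<in> J"
      "\<And>a x. a \<in> J \<Longrightarrow> x \<in> space M \<Longrightarrow> x \<in> cyl a \<longleftrightarrow> a = \<iota> x"
    and W: "\<And>a. a \<in> J \<Longrightarrow> W a > 0" "(\<Sum>a\<in>J. W a) \<le> 1"
    and G: "integrable M G" "\<And>a x. a \<in> J \<Longrightarrow> x \<in> cyl a \<Longrightarrow> - ln (W a) \<le> G x"
  shows "(\<Sum>a\<in>J. - (prob (cyl a) * ln (prob (cyl a)))) \<le> (\<integral>x. G x \<partial>M)"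
proof -
  have ind: "(\<Sum>a\<in>J. indicator (cyl a) x) = (1::real)" if x: "x \<in> space M" for x
  proof -
    have "(\<Sum>a\<in>J. indicator (cyl a) x) = (\<Sum>a\<in>J. if a = \<iota> x then 1 else 0 :: real)"
      using \<iota>(2) x by (intro sum.cong) (auto simp: indicator_def)
    then show ?thesis using \<iota>(1)[OF x] J by simp
  qed
  have int: "integrable M (\<lambda>x. indicator (cyl a) x * H x)" if "a \<in> J" "integrable M H"
    for a and H :: "'a \<Rightarrow> real"
    using integrable_mult_indicator[OF cyl[OF that(1)] that(2)] by simp
  have "(\<Sum>a\<in>J. prob (cyl a)) = (\<Sum>a\<in>J. \<integral>x. indicator (cyl a) x * 1 \<partial>M)"
    using cyl by (intro sum.cong) (auto simp: Int_absorb2 sets.sets_into_space)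
  also have "\<dots> = (\<integral>x. (\<Sum>a\<in>J. indicator (cyl a) x * 1) \<partial>M)"
    by (rule Bochner_Integration.integral_sum[symmetric], rule int) auto
  also have "\<dots> = (\<integral>x. 1 \<partial>M)" using ind by (intro Bochner_Integration.integral_cong) auto
  finally have sum1: "(\<Sum>a\<in>J. prob (cyl a)) = 1" by (simp add: prob_space)
  \<comment> \<open>The excess \<open>W a - prob (cyl a)\<close> sums to at most 0 over
    \<open>J\<close>. For a null cell everything vanishes except \<open>W a > 0\<close>.\<close>
  have "- (prob (cyl a) * ln (prob (cyl a))) \<le> prob (cyl a) * (- ln (W a)) + (W a - prob (cyl a))"
    if a: "a \<in> J" for a
  proof (cases "prob (cyl a) = 0")
    case False
    then have p: "prob (cyl a) > 0" by (simp add: zero_less_measure_iff)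
    have "ln (W a / prob (cyl a)) \<le> W a / prob (cyl a) - 1"
      using p W(1)[OF a] by (intro ln_le_minus_one) simp
    then have "prob (cyl a) * (ln (W a) - ln (prob (cyl a))) \<le> prob (cyl a) * (W a / prob (cyl a) - 1)"
      using p W(1)[OF a] by (intro mult_left_mono) (auto simp: ln_div)
    also have "\<dots> = W a - prob (cyl a)" using p by (simp add: field_simps)
    finally show ?thesis by (simp add: algebra_simps)
  qed (use W(1)[OF a] in simp)
  then have "(\<Sum>a\<in>J. - (prob (cyl a) * ln (prob (cyl a)))) \<le>
      (\<Sum>a\<in>J. prob (cyl a) * (- ln (W a)) + (W a - prob (cyl a)))"
    by (rule sum_mono)
  also have "\<dots> = (\<Sum>a\<in>J. prob (cyl a) * (- ln (W a))) + ((\<Sum>a\<in>J. W a) - 1)"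
    by (simp only: sum.distrib sum_subtractf sum1)
  also have "\<dots> \<le> (\<Sum>a\<in>J. prob (cyl a) * (- ln (W a)))" using W(2) by simp
  also have "\<dots> \<le> (\<Sum>a\<in>J. \<integral>x. indicator (cyl a) x * G x \<partial>M)"
  proof (rule sum_mono)
    fix a assume a: "a \<in> J"
    have "prob (cyl a) * (- ln (W a)) = (\<integral>x. indicator (cyl a) x * (- ln (W a)) \<partial>M)"
      using cyl[OF a] by (simp add: Int_absorb2 sets.sets_into_space)
    also have "\<dots> \<le> (\<integral>x. indicator (cyl a) x * G x \<partial>M)"
      by (rule integral_mono; (rule int)?) (use a G in \<open>auto simp: indicator_def\<close>)
    finally show "prob (cyl a) * (- ln (W a)) \<le> (\<integral>x. indicator (cyl a) x * G x \<partial>M)" .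
  qed
  also have "\<dots> = (\<integral>x. (\<Sum>a\<in>J. indicator (cyl a) x * G x) \<partial>M)"
    by (rule Bochner_Integration.integral_sum[symmetric], rule int) (use G in auto)
  also have "\<dots> = (\<integral>x. G x \<partial>M)"
    using ind by (intro Bochner_Integration.integral_cong) (auto simp: sum_distrib_right[symmetric])
  finally show ?thesis .
qed

section \<open>Integrals along orbits for an invariant measure\<close>

locale invariant_measure = hyperbolic_homeo d f k \<epsilon>
  for d :: "'a::topological_space \<Rightarrow> 'a \<Rightarrow> real" and f :: "'a \<Rightarrow> 'a" and k \<epsilon> :: real +
  fixes M :: "'a measure"
  assumes invariant: "invariant_borel_prob f M"
begin

sublocale prob_space M
  using invariant by (simp add: invariant_borel_prob_def)

lemma sets_M: "sets M = sets borel"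
  using invariant by (simp add: invariant_borel_prob_def)

lemma space_M [simp]: "space M = UNIV"
  using sets_eq_imp_space_eq[OF sets_M] by simp

lemma prob_UNIV [simp]: "prob UNIV = 1"
  using prob_space by simp

lemma measurable_funpow: "f ^^ n \<in> M \<rightarrow>\<^sub>M M"
proof (induction n)
  case (Suc n)
  have "f \<in> M \<rightarrow>\<^sub>M M" using invariant by (simp add: invariant_borel_prob_def)
  with Suc show ?case unfolding funpow.simps by (rule measurable_comp)
qed simp

lemma distr_funpow: "distr M M (f ^^ n) = M"
proof (induction n)
  case (Suc n)
  have f: "f \<in> M \<rightarrow>\<^sub>M M" "distr M M f = M" using invariant by (simp_all add: invariant_borel_prob_def)
  have "distr M M (f ^^ Suc n) = distr (distr M M (f ^^ n)) M f"
    unfolding funpow.simps by (rule distr_distr[symmetric, OF f(1) measurable_funpow])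
  then show ?case by (simp only: Suc f(2))
qed (simp add: distr_id)

lemma
  assumes "A \<in> sets M"
  shows vimage_funpow_sets: "(f ^^ n) -` A \<in> sets M"
    and measure_vimage_funpow: "measure M ((f ^^ n) -` A) = measure M A"
  using measurable_sets[OF measurable_funpow assms, of n]
    measure_distr[OF measurable_funpow assms, of n] distr_funpow by simp_all

lemma
  assumes A: "A \<in> sets M"
  shows integrable_indicator_funpow: "integrable M (\<lambda>x. indicator A ((f ^^ n) x) :: real)"
    and integral_indicator_funpow: "(\<integral>x. indicator A ((f ^^ n) x) \<partial>M) = measure M A"
proof -
  have eq: "(\<lambda>x. indicator A ((f ^^ n) x) :: real) = indicator ((f ^^ n) -` A)"
    by (auto simp: indicator_def)
  show "integrable M (\<lambda>x. indicator A ((f ^^ n) x) :: real)"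
    unfolding eq using vimage_funpow_sets[OF A, of n]
    by (intro integrable_real_indicator) (simp_all add: emeasure_finite less_top[symmetric])
  show "(\<integral>x. indicator A ((f ^^ n) x) \<partial>M) = measure M A"
    unfolding eq using vimage_funpow_sets[OF A, of n] measure_vimage_funpow[OF A, of n] by simp
qed

text \<open>By invariance every time \<open>t j\<close> contributes the same expectation, so only
  the number of times counts.\<close>

lemma
  fixes a b :: real
  assumes A: "A \<in> sets M"
  shows integrable_visits: "integrable M (\<lambda>x. \<Sum>j<n. a + b * indicator A ((f ^^ t j) x))"
    and integral_visits: "(\<integral>x. (\<Sum>j<n. a + b * indicator A ((f ^^ t j) x)) \<partial>M) = real n * (a + b * measure M A)"
proof -
  have int: "integrable M (\<lambda>x. b * indicator A ((f ^^ t j) x))" for j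
    by (intro integrable_mult_right integrable_indicator_funpow[OF A])
  then have int': "integrable M (\<lambda>x. a + b * indicator A ((f ^^ t j) x))" for j
    by (intro Bochner_Integration.integrable_add integrable_const)
  then show "integrable M (\<lambda>x. \<Sum>j<n. a + b * indicator A ((f ^^ t j) x))"
    by (intro Bochner_Integration.integrable_sum)
  have "(\<integral>x. a + b * indicator A ((f ^^ t j) x) \<partial>M) = a + b * measure M A" for j
    by (subst Bochner_Integration.integral_add[OF integrable_const int])
      (simp add: prob_space integral_indicator_funpow[OF A])
  then show "(\<integral>x. (\<Sum>j<n. a + b * indicator A ((f ^^ t j) x)) \<partial>M) = real n * (a + b * measure M A)"
    by (subst Bochner_Integration.integral_sum[OF int']) simp
qed

text \<open>Passes from cylinders as sets to cylinders as names, the form Gibbs' inequality takes.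
  Names sharing a cylinder only add nonnegative terms.\<close>

lemma entropy_le_cylinder_sum:
  assumes \<alpha>: "finite \<alpha>"
  defines "cyl \<equiv> (\<lambda>n a. \<Inter>i<n. (f ^^ i) -` a i)"
  shows "partition_entropy M (dyn_join f \<alpha> n) \<le>
    (\<Sum>a\<in>PiE {..<n} (\<lambda>_. \<alpha>). - (prob (cyl n a) * ln (prob (cyl n a))))"
proof -
  let ?J = "PiE {..<n} (\<lambda>_. \<alpha>)"
  have fin: "finite ?J" using \<alpha> by (intro finite_PiE) auto
  have "dyn_join f \<alpha> n \<subseteq> cyl n ` ?J"
  proof
    fix S assume "S \<in> dyn_join f \<alpha> n"
    then obtain A where A: "S = (\<Inter>i<n. (f ^^ i) -` A i)" "\<forall>i<n. A i \<in> \<alpha>"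
      unfolding dyn_join_def by blast
    have "restrict A {..<n} \<in> ?J" using A(2) by auto
    moreover have "S = cyl n (restrict A {..<n})" unfolding A(1) cyl_def by simp
    ultimately show "S \<in> cyl n ` ?J" by blast
  qed
  moreover have nonneg: "- (prob S * ln (prob S)) \<ge> 0" for S
    using prob_le_1[of S] by (cases "prob S = 0")
      (auto simp: mult_le_0_iff zero_less_measure_iff intro!: mult_nonneg_nonpos)
  ultimately have "partition_entropy M (dyn_join f \<alpha> n) \<le> (\<Sum>S\<in>cyl n ` ?J. - (prob S * ln (prob S)))"
    unfolding partition_entropy_def sum_negf[symmetric] using fin by (intro sum_mono2) auto
  also have "\<dots> \<le> (\<Sum>a\<in>?J. - (prob (cyl n a) * ln (prob (cyl n a))))"
    using sum_image_le[OF fin, of "\<lambda>S. - (prob S * ln (prob S))" "cyl n"] nonneg by (simp add: o_def)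
  finally show ?thesis .
qed

text \<open>
  A code of order \<open>n\<close> yields weights on the \<open>n\<close>-cylinders of \<open>\<alpha>\<close>: given a code set, the
  itinerary of a point of it is predicted, with error probability \<open>\<tau>\<close> at each time, from
  the orbit of a fixed representative of the set.
\<close>

lemma entropy_le_coded:
  assumes \<alpha>: "finite \<alpha>" "\<alpha> \<subseteq> sets M" "partition_on (space M) \<alpha>" and \<theta>: "\<theta> > 0"
  obtains B where "\<And>n \<Phi>. coded n UNIV \<Phi> \<Longrightarrow> integrable M \<Phi> \<Longrightarrow>
    partition_entropy M (dyn_join f \<alpha> n) \<le> (\<integral>x. \<Phi> x \<partial>M) + real n * \<theta> + B"
proof -
  have cover: "\<Union>\<alpha> = UNIV" and disj: "\<And>A B x. A \<in> \<alpha> \<Longrightarrow> B \<in> \<alpha> \<Longrightarrow> x \<in> A \<Longrightarrow> x \<in> B \<Longrightarrow> A = B"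
    using \<alpha>(3) by (auto simp: partition_on_def disjoint_def)
  define atom where "atom x = (THE A. A \<in> \<alpha> \<and> x \<in> A)" for x
  have atom: "atom x \<in> \<alpha>" "x \<in> atom x" and atom_eq: "A \<in> \<alpha> \<Longrightarrow> x \<in> A \<Longrightarrow> A = atom x" for x A
  proof -
    have "\<exists>A. A \<in> \<alpha> \<and> x \<in> A" using cover by blast
    then have "\<exists>!A. A \<in> \<alpha> \<and> x \<in> A" using disj by metis
    then have "atom x \<in> \<alpha> \<and> x \<in> atom x" unfolding atom_def by (rule theI')
    then show "atom x \<in> \<alpha>" "x \<in> atom x" by auto
    then show "A \<in> \<alpha> \<Longrightarrow> x \<in> A \<Longrightarrow> A = atom x" using disj by metis
  qed
  define s where "s = real (card \<alpha>)"
  have s: "s \<ge> 1" using \<alpha>(1) atom(1) unfolding s_def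
    by (metis One_nat_def Suc_leI card_gt_0_iff empty_iff of_nat_1 of_nat_le_iff)
  \<comment> \<open>Chosen so that a correct prediction costs exactly \<open>\<theta> / 2\<close>;
    the other half of \<open>\<theta>\<close> is reserved for errors, each costing
    \<open>L\<close>.\<close>
  define \<tau> where "\<tau> = 1 - exp (- \<theta> / 2)"
  have \<tau>: "0 < \<tau>" "\<tau> < 1" "- ln (1 - \<tau>) = \<theta> / 2" using \<theta> by (auto simp: \<tau>_def)
  define L where "L = ln (s / \<tau>)"
  have L: "L \<ge> 0" "- ln (\<tau> / s) = L"
    using s \<tau> by (auto simp: L_def ln_div)
  \<comment> \<open>A bad set of measure at most \<open>\<theta>'\<close> causes an average penalty
    \<open>L * \<theta>'\<close> of at most \<open>\<theta> / 2\<close> per step. The summand 1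
    keeps the denominator positive.\<close>
  define \<theta>' where "\<theta>' = \<theta> / (2 * (L + 1))"
  have \<theta>': "\<theta>' > 0" "L * \<theta>' \<le> \<theta> / 2" using \<theta> L(1) by (auto simp: \<theta>'_def field_simps)
  \<comment> \<open>Nearby points may lie in different atoms. After discarding a set of small
    measure, the remaining closed parts of the atoms can be told apart at a positive scale.\<close>
  have "\<exists>F. closed F \<and> F \<subseteq> A \<and> prob (A - F) < \<theta>' / s" if "A \<in> \<alpha>" for A
  proof -
    have "A \<in> sets borel" using that \<alpha>(2) sets_M by auto
    from closed_open_approximation[OF finite_measure_axioms sets_M this, rule_format, of "\<theta>' / s"]
    obtain F U where FU: "closed F" "open U" "F \<subseteq> A" "A \<subseteq> U" "prob (U - F) < \<theta>' / s"
      using \<theta>' s by auto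
    have "prob (A - F) \<le> prob (U - F)"
      using FU sets_M by (intro finite_measure_mono) auto
    with FU show ?thesis by auto
  qed
  then have "\<forall>A\<in>\<alpha>. \<exists>F. closed F \<and> F \<subseteq> A \<and> prob (A - F) < \<theta>' / s" by blast
  then obtain F where "\<forall>A\<in>\<alpha>. closed (F A) \<and> F A \<subseteq> A \<and> prob (A - F A) < \<theta>' / s"
    by (rule bchoice[THEN exE])
  then have F: "closed (F A)" "F A \<subseteq> A" "prob (A - F A) < \<theta>' / s" if "A \<in> \<alpha>" for A using that by auto
  define bad where "bad = - (\<Union>A\<in>\<alpha>. F A)"
  have "open bad" unfolding bad_def using \<alpha>(1) F(1) by (auto intro!: closed_UN)
  then have bad_sets: "bad \<in> sets M" using sets_M by simp
  have "prob bad \<le> prob (\<Union>A\<in>\<alpha>. A - F A)"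
  proof (rule finite_measure_mono)
    show "bad \<subseteq> (\<Union>A\<in>\<alpha>. A - F A)" using cover by (auto simp: bad_def)
    show "(\<Union>A\<in>\<alpha>. A - F A) \<in> sets M"
      using \<alpha> F(1) sets_M by (intro sets.finite_UN sets.Diff) auto
  qed
  also have "\<dots> \<le> (\<Sum>A\<in>\<alpha>. prob (A - F A))"
    using \<alpha> F(1) sets_M by (intro finite_measure_subadditive_finite) auto
  also have "\<dots> \<le> (\<Sum>A\<in>\<alpha>. \<theta>' / s)" using F(3) by (intro sum_mono) (auto intro: less_imp_le)
  also have "\<dots> = \<theta>'" using s by (simp add: s_def)
  finally have prob_bad: "prob bad \<le> \<theta>'" .
  \<comment> \<open>Each member of this open cover meets at most one of the sets \<open>F A\<close>.
    Hence a ball whose radius is a Lebesgue number determines the atom of every point in it that is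
    not bad; this atom will be \<open>guess y\<close>.\<close>
  define \<U> where "\<U> = (\<lambda>A. - (\<Union>B\<in>\<alpha> - {A}. F B)) ` \<alpha>"
  have "\<exists>\<delta>>0. \<forall>x. \<exists>U\<in>\<U>. {y. d x y < \<delta>} \<subseteq> U"
  proof (rule Lebesgue_number)
    show "open U" if "U \<in> \<U>" for U
      using that \<alpha>(1) F(1) unfolding \<U>_def by (auto intro!: closed_UN)
    have "x \<in> - (\<Union>B\<in>\<alpha> - {atom x}. F B)" for x using atom_eq F(2) by blast
    then show "\<Union>\<U> = UNIV" unfolding \<U>_def using atom(1) by blast
  qed
  then obtain \<delta> where \<delta>: "\<delta> > 0" "\<forall>y. \<exists>A\<in>\<alpha>. {x. d y x < \<delta>} \<subseteq> - (\<Union>B\<in>\<alpha> - {A}. F B)"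
    unfolding \<U>_def by auto
  have "\<forall>y. \<exists>A. A \<in> \<alpha> \<and> (\<forall>B\<in>\<alpha>. \<forall>x\<in>F B. d y x < \<delta> \<longrightarrow> B = A)"
  proof
    fix y
    obtain A where "A \<in> \<alpha>" "{x. d y x < \<delta>} \<subseteq> - (\<Union>B\<in>\<alpha> - {A}. F B)" using \<delta>(2) by blast
    then show "\<exists>A. A \<in> \<alpha> \<and> (\<forall>B\<in>\<alpha>. \<forall>x\<in>F B. d y x < \<delta> \<longrightarrow> B = A)" by (intro exI[of _ A]) auto
  qed
  then obtain guess where "\<forall>y. guess y \<in> \<alpha> \<and> (\<forall>B\<in>\<alpha>. \<forall>x\<in>F B. d y x < \<delta> \<longrightarrow> B = guess y)"
    by (rule choice[THEN exE])
  then have guess: "guess y \<in> \<alpha>" "B \<in> \<alpha> \<Longrightarrow> x \<in> F B \<Longrightarrow> d y x < \<delta> \<Longrightarrow> B = guess y" for y B x by auto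
  define \<kappa> where "\<kappa> A y = (if A = guess y then 1 - \<tau> else \<tau> / s)" for A y
  have \<kappa>_pos: "\<kappa> A y > 0" for A y using \<tau> s by (simp add: \<kappa>_def)
  have \<kappa>_sum: "(\<Sum>A\<in>\<alpha>. \<kappa> A y) \<le> 1" for y
  proof -
    have "(\<Sum>A\<in>\<alpha>. \<kappa> A y) \<le> (\<Sum>A\<in>\<alpha>. (if A = guess y then 1 - \<tau> else 0) + \<tau> / s)"
      using \<tau> s by (intro sum_mono) (simp add: \<kappa>_def)
    also have "\<dots> = 1 - \<tau> + s * (\<tau> / s)" using \<alpha>(1) guess(1) by (simp add: sum.distrib s_def)
    also have "\<dots> = 1" using s by simp
    finally show ?thesis .
  qed
  have \<kappa>_le: "- ln (\<kappa> A y) \<le> \<theta> / 2 + L" for A y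
    using \<tau>(3) L \<theta> by (simp add: \<kappa>_def)
  have \<kappa>_guess: "- ln (\<kappa> A y) = \<theta> / 2" if "A = guess y" for A y using that \<tau>(3) by (simp add: \<kappa>_def)
  \<comment> \<open>After \<open>m\<close> steps away from both ends, \<open>contraction\<close>
    brings orbits within the scale \<open>\<delta>\<close>. As \<open>m\<close> does not depend on
    \<open>n\<close>, the end effects stay bounded.\<close>
  obtain m where m: "\<epsilon> / k ^ m < \<delta>"
  proof -
    obtain m where "\<epsilon> / \<delta> < k ^ m" using real_arch_pow[OF k] by blast
    then have "\<epsilon> / k ^ m < \<delta>" using \<delta>(1) k by (simp add: field_simps)
    then show ?thesis by (rule that)
  qed
  have "partition_entropy M (dyn_join f \<alpha> n) \<le> (\<integral>x. \<Phi> x \<partial>M) + real n * \<theta> + 2 * real m * L"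
    if cod: "coded n UNIV \<Phi>" and int\<Phi>: "integrable M \<Phi>" for n \<Phi>
  proof -
    define cyl where "cyl n a = (\<Inter>i<n. (f ^^ i) -` a i)" for n and a :: "nat \<Rightarrow> 'a set"
    define J where "J = PiE {..<n} (\<lambda>_. \<alpha>)"
    obtain C where C: "code n UNIV \<Phi> C" using cod by (rule codedE)
    \<comment> \<open>For an empty code set this is an arbitrary point. The sum of the weights is
      still at most 1, and the length estimate uses only a code set containing
      \<open>x\<close>.\<close>
    define z where "z c = (SOME y. y \<in> fst c)" for c :: "'a set \<times> real"
    \<comment> \<open>The joint weight of a code set and of an itinerary predicted along the orbit
      of its representative; \<open>W\<close> is the marginal on itineraries.\<close>
    define P where "P a c = snd c * (\<Prod>i<n. \<kappa> (a i) ((f ^^ i) (z c)))" for a and c :: "'a set \<times> real"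
    define W where "W a = (\<Sum>c\<leftarrow>C. P a c)" for a
    \<comment> \<open>The cost of the code set, then of prediction with a penalty at each bad time,
      then a penalty for the at most \<open>2 * m\<close> times near the two ends.\<close>
    define G where "G x = \<Phi> x + (\<Sum>i<n. \<theta> / 2 + L * indicator bad ((f ^^ i) x)) + 2 * real m * L" for x
    have P_pos: "P a c > 0" if "c \<in> set C" for a c
      unfolding P_def using code_pos[OF C that] \<kappa>_pos by (intro mult_pos_pos prod_pos) auto
    have P_le_W: "P a c \<le> W a" if "c \<in> set C" for a c
      unfolding W_def using that P_pos by (intro member_le_sum_list) (auto intro: less_imp_le)
    have "finite J" unfolding J_def using \<alpha>(1) by (intro finite_PiE) auto
    have "(\<Sum>a\<in>J. - (prob (cyl n a) * ln (prob (cyl n a)))) \<le> (\<integral>x. G x \<partial>M)"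
    proof (rule Gibbs_inequality[where \<iota> = "\<lambda>x. \<lambda>i\<in>{..<n}. atom ((f ^^ i) x)" and W = W])
      show "finite J" by fact
      show "cyl n a \<in> sets M" if "a \<in> J" for a
      proof (cases "n = 0")
        case False
        then show ?thesis unfolding cyl_def
          using that \<alpha>(2) vimage_funpow_sets unfolding J_def by (intro sets.finite_INT) auto
      qed (use sets.top[of M] in \<open>simp add: cyl_def\<close>)
      show "(\<lambda>i\<in>{..<n}. atom ((f ^^ i) x)) \<in> J" for x unfolding J_def using atom(1) by auto
      show "x \<in> cyl n a \<longleftrightarrow> a = (\<lambda>i\<in>{..<n}. atom ((f ^^ i) x))" if a: "a \<in> J" for a x
      proof
        assume x: "x \<in> cyl n a"
        show "a = (\<lambda>i\<in>{..<n}. atom ((f ^^ i) x))"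
        proof (rule PiE_ext[OF a[unfolded J_def]])
          show "(\<lambda>i\<in>{..<n}. atom ((f ^^ i) x)) \<in> PiE {..<n} (\<lambda>_. \<alpha>)" using atom(1) by auto
          show "a i = (\<lambda>i\<in>{..<n}. atom ((f ^^ i) x)) i" if "i \<in> {..<n}" for i
            using that x a atom_eq[of "a i" "(f ^^ i) x"] by (auto simp: cyl_def J_def)
        qed
      next
        assume "a = (\<lambda>i\<in>{..<n}. atom ((f ^^ i) x))"
        then show "x \<in> cyl n a" using atom(2) by (auto simp: cyl_def)
      qed
      show "W a > 0" for a
      proof -
        obtain c where "c \<in> set C" using code_cover[OF C UNIV_I] by blast
        then show ?thesis using P_pos P_le_W by (meson order_less_le_trans)
      qed
      have "(\<Sum>a\<in>J. W a) = (\<Sum>j<length C. \<Sum>a\<in>J. P a (C ! j))"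
        unfolding W_def sum_list_sum_nth
        by (subst sum.swap) (simp add: atLeast0LessThan)
      also have "\<dots> \<le> (\<Sum>j<length C. snd (C ! j))"
      proof (rule sum_mono)
        fix j assume j: "j \<in> {..<length C}"
        \<comment> \<open>Summed over all itineraries, the product factors into one sum over
          \<open>\<alpha>\<close> for each time.\<close>
        have "(\<Sum>a\<in>J. P a (C ! j)) = snd (C ! j) * (\<Prod>i<n. \<Sum>A\<in>\<alpha>. \<kappa> A ((f ^^ i) (z (C ! j))))"
          unfolding P_def J_def sum_distrib_left[symmetric]
          by (subst prod_sum_PiE) (use \<alpha>(1) in auto)
        also have "\<dots> \<le> snd (C ! j) * 1"
          using code_pos[OF C, of "C ! j"] j
          by (intro mult_left_mono prod_le_1 conjI \<kappa>_sum sum_nonneg less_imp_le[OF \<kappa>_pos]) auto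
        finally show "(\<Sum>a\<in>J. P a (C ! j)) \<le> snd (C ! j)" by simp
      qed
      also have "\<dots> = sum_list (map snd C)" by (simp add: sum_list_sum_nth atLeast0LessThan)
      also have "\<dots> \<le> 1" by (rule code_sum[OF C])
      finally show "(\<Sum>a\<in>J. W a) \<le> 1" .
      show "integrable M G"
        unfolding G_def
        by (intro Bochner_Integration.integrable_add integrable_visits int\<Phi> bad_sets integrable_const)
      show "- ln (W a) \<le> G x" if a: "a \<in> J" and x: "x \<in> cyl n a" for a x
      proof -
        obtain c where c: "c \<in> set C" "x \<in> fst c" "- ln (snd c) \<le> \<Phi> x"
          using code_cover[OF C UNIV_I] by blast
        have zc: "z c \<in> fst c" unfolding z_def using c(2) by (rule someI)
        have close: "d ((f ^^ i) (z c)) ((f ^^ i) x) < \<epsilon>" if "i < n" for i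
          using code_small[OF C c(1)] zc c(2) that by (simp add: small_def)
        define E where "E = {i. i < n \<and> (i < m \<or> n \<le> i + m)}"
        have "E \<subseteq> {..<m} \<union> {n - m..<n}" by (auto simp: E_def)
        then have "card E \<le> card ({..<m} \<union> {n - m..<n})" by (intro card_mono) auto
        also have "\<dots> \<le> m + m" by (intro order_trans[OF card_Un_le] add_mono) auto
        finally have "card E \<le> 2 * m" by simp
        have E: "(\<Sum>i<n. L * indicator E i) \<le> 2 * real m * L"
        proof -
          have "{..<n} \<inter> E = E" by (auto simp: E_def)
          then have "(\<Sum>i<n. L * indicator E i) = L * real (card E)"
            by (simp add: sum_distrib_left[symmetric] indicator_def sum.If_cases)
          also have "\<dots> \<le> L * real (2 * m)"
            using \<open>card E \<le> 2 * m\<close> L(1) by (intro mult_left_mono of_nat_mono) auto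
          finally show ?thesis by (simp add: mult.commute)
        qed
        have cost: "- ln (\<kappa> (a i) ((f ^^ i) (z c))) \<le> \<theta> / 2 + L * indicator bad ((f ^^ i) x) + L * indicator E i"
          if i: "i < n" for i
        proof (cases "(f ^^ i) x \<in> bad \<or> i \<in> E")
          case True
          then have "L * 1 \<le> L * indicator bad ((f ^^ i) x) + L * indicator E i"
            using L(1) by (auto simp: indicator_def)
          then show ?thesis using \<kappa>_le[of "a i" "(f ^^ i) (z c)"] by simp
        next
          case False
          then obtain A where A: "A \<in> \<alpha>" "(f ^^ i) x \<in> F A" by (auto simp: bad_def)
          have "a i \<in> \<alpha>" "(f ^^ i) x \<in> a i" using a x i by (auto simp: J_def cyl_def)
          moreover have "(f ^^ i) x \<in> A" using A F(2) by blast
          ultimately have "a i = A" using A(1) disj by metis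
          have "m \<le> i" "i + m < n" using False i by (auto simp: E_def)
          then have "d ((f ^^ i) (z c)) ((f ^^ i) x) \<le> \<epsilon> / k ^ m"
            using contraction[of n "z c" x m i] close by simp
          then have "A = guess ((f ^^ i) (z c))" using m A by (intro guess(2)) auto
          then have "- ln (\<kappa> (a i) ((f ^^ i) (z c))) = \<theta> / 2" using \<open>a i = A\<close> by (intro \<kappa>_guess) simp
          then show ?thesis using False by simp
        qed
        have "- ln (W a) \<le> - ln (P a c)"
          unfolding neg_le_iff_le by (rule ln_mono[OF P_le_W[OF c(1)] P_pos[OF c(1)]])
        also have "\<dots> = - ln (snd c) + (\<Sum>i<n. - ln (\<kappa> (a i) ((f ^^ i) (z c))))"
        proof -
          have nz: "\<kappa> A y \<noteq> 0" for A y using \<kappa>_pos[of A y] by simp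
          have "ln (P a c) = ln (snd c) + ln (\<Prod>i<n. \<kappa> (a i) ((f ^^ i) (z c)))"
            unfolding P_def by (intro ln_mult_pos prod_pos code_pos[OF C c(1)] \<kappa>_pos)
          also have "ln (\<Prod>i<n. \<kappa> (a i) ((f ^^ i) (z c))) = (\<Sum>i<n. ln (\<kappa> (a i) ((f ^^ i) (z c))))"
            using nz by (intro ln_prod) auto
          finally show ?thesis by (simp add: sum_negf)
        qed
        also have "\<dots> \<le> \<Phi> x + (\<Sum>i<n. \<theta> / 2 + L * indicator bad ((f ^^ i) x) + L * indicator E i)"
          using c(3) cost by (intro add_mono sum_mono) auto
        also have "\<dots> \<le> G x" unfolding G_def using E by (simp add: sum.distrib)
        finally show ?thesis .
      qed
    qed
    also have "(\<integral>x. G x \<partial>M) = (\<integral>x. \<Phi> x \<partial>M) + real n * (\<theta> / 2 + L * prob bad) + 2 * real m * L"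
    proof -
      note int = integrable_visits[OF bad_sets, where t = "\<lambda>i. i"]
      show ?thesis
        unfolding G_def Bochner_Integration.integral_add[OF Bochner_Integration.integrable_add[OF int\<Phi> int] integrable_const]
          Bochner_Integration.integral_add[OF int\<Phi> int] integral_visits[OF bad_sets, where t = "\<lambda>i. i"]
        by (simp add: prob_space)
    qed
    also have "\<dots> \<le> (\<integral>x. \<Phi> x \<partial>M) + real n * \<theta> + 2 * real m * L"
    proof -
      have "L * prob bad \<le> L * \<theta>'" using prob_bad L(1) by (rule mult_left_mono)
      then have "\<theta> / 2 + L * prob bad \<le> \<theta>" using \<theta>'(2) by linarith
      then show ?thesis by (intro add_mono mult_left_mono) auto
    qed
    finally show ?thesis
      using entropy_le_cylinder_sum[OF \<alpha>(1), of n] unfolding J_def cyl_def by linarith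
  qed
  then show ?thesis by (rule that)
qed

end

section \<open>Measure of Bowen balls\<close>

context hyperbolic_homeo
begin

text \<open>All members get the same weight \<open>1 / card \<S>\<close>.\<close>

lemma coded_family:
  assumes \<S>: "finite \<S>" "\<S> \<noteq> {}" "\<And>S. S \<in> \<S> \<Longrightarrow> small n S" "D \<subseteq> \<Union>\<S>"
  shows "coded n D (\<lambda>_. ln (card \<S>))"
proof -
  obtain Ss where Ss: "set Ss = \<S>" "distinct Ss" using \<S>(1) finite_distinct_list by blast
  define c where "c = real (card \<S>)"
  have c: "c > 0" using \<S>(1,2) by (simp add: c_def card_gt_0_iff)
  have "code n D (\<lambda>_. ln c) (map (\<lambda>S. (S, 1 / c)) Ss)"
  proof (rule codeI)
    have "length Ss = card \<S>" using Ss distinct_card by fastforce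
    then show "sum_list (map snd (map (\<lambda>S. (S, 1 / c)) Ss)) \<le> 1"
      using c by (simp add: o_def sum_list_triv c_def)
  next
    fix x assume "x \<in> D"
    then obtain S where "S \<in> \<S>" "x \<in> S" using \<S>(4) by blast
    then show "\<exists>b\<in>set (map (\<lambda>S. (S, 1 / c)) Ss). x \<in> fst b \<and> - ln (snd b) \<le> ln c"
      using Ss(1) c by (intro bexI[of _ "(S, 1 / c)"]) (auto simp: ln_div)
  qed (use \<S>(3) Ss(1) c in auto)
  then show ?thesis by (auto simp: coded_def c_def)
qed

text \<open>The radius is half of \<open>\<epsilon>\<close> so that any two points of the ball stay
  \<open>\<epsilon>\<close>-close, which makes it \<open>small\<close>.\<close>

definition bowen_ball :: "nat \<Rightarrow> 'a \<Rightarrow> 'a set" where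
  "bowen_ball n x = {y. \<forall>i<n. d ((f ^^ i) x) ((f ^^ i) y) < \<epsilon> / 2}"

lemma small_bowen_ball: "small n (bowen_ball n c)"
  unfolding small_def
proof (intro ballI allI impI)
  fix x y i assume "x \<in> bowen_ball n c" "y \<in> bowen_ball n c" "i < n"
  then have "d ((f ^^ i) c) ((f ^^ i) x) < \<epsilon> / 2" "d ((f ^^ i) c) ((f ^^ i) y) < \<epsilon> / 2"
    by (auto simp: bowen_ball_def)
  then show "d ((f ^^ i) x) ((f ^^ i) y) < \<epsilon>"
    using dist_triangle[of "(f ^^ i) x" "(f ^^ i) y" "(f ^^ i) c"] dist_sym[of "(f ^^ i) c" "(f ^^ i) x"]
    by simp
qed

lemma center_in_bowen_ball: "x \<in> bowen_ball n x"
  using \<epsilon> by (simp add: bowen_ball_def)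

lemma open_bowen_ball: "open (bowen_ball n x)"
proof -
  have "bowen_ball n x = (\<Inter>i\<in>{..<n}. (f ^^ i) -` {y. d ((f ^^ i) x) y < \<epsilon> / 2})"
    by (auto simp: bowen_ball_def)
  also have "open \<dots>" by (intro open_INT ballI open_vimage_funpow open_dist_less) simp
  finally show ?thesis .
qed

lemma coded_0: "coded 0 UNIV (\<lambda>_. 0)"
  using coded_family[of "{UNIV}" 0 UNIV] by (simp add: small_def)

text \<open>A crude bound from repeating one finite cover at every step; it serves to show that the
  metric entropy is finite.\<close>

lemma coded_linear:
  obtains c :: real where "\<And>n. coded n UNIV (\<lambda>_. real n * c)"
proof -
  have "UNIV \<subseteq> (\<Union>x\<in>UNIV. bowen_ball 1 x)" using center_in_bowen_ball by blast
  then obtain F where F: "finite F" "UNIV \<subseteq> (\<Union>x\<in>F. bowen_ball 1 x)"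
    by (rule compactE_image[OF compact_UNIV open_bowen_ball])
  define c where "c = ln (card (bowen_ball 1 ` F))"
  have 1: "coded 1 UNIV (\<lambda>_. c)"
    unfolding c_def using F small_bowen_ball by (intro coded_family) auto
  have "coded n UNIV (\<lambda>_. real n * c)" for n
  proof (induction n)
    case (Suc n)
    show ?case using coded_concat[OF Suc 1] by (simp add: algebra_simps)
  qed (use coded_0 in simp)
  then show ?thesis by (rule that)
qed

text \<open>The growth bound provides a separated set of greatest cardinality. Its Bowen balls cover
  the space, since a point outside all of them could be added to the set.\<close>

lemma coded_spanning:
  assumes h: "h \<ge> 0"
    and growth: "\<And>n F. separated n (\<epsilon> / 2) F \<Longrightarrow> n \<ge> 1 \<Longrightarrow> F \<noteq> {} \<Longrightarrow> ln (card F) \<le> h * real (n + g)"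
  shows "coded n UNIV (\<lambda>_. h * real (n + g))"
\<comment> \<open>\<open>growth\<close> says nothing about \<open>n = 0\<close>, but a stretch of
  length 0 before a visit has to be coded as well.\<close>
proof (cases "n = 0")
  case True
  then show ?thesis using h by (intro coded_mono[OF coded_0]) auto
next
  case False
  then have n: "n \<ge> 1" by simp
  let ?P = "\<lambda>F. separated n (\<epsilon> / 2) F \<and> F \<noteq> {}"
  have e2: "\<epsilon> / 2 > 0" using \<epsilon> by simp
  have "card F \<le> nat \<lceil>exp (h * real (n + g))\<rceil>" if F: "?P F" for F
  proof -
    have "card F > 0" using separated_card_le(1)[of n "\<epsilon> / 2" F] F e2 by (simp add: card_gt_0_iff)
    then have "real (card F) = exp (ln (card F))" by simp
    also have "\<dots> \<le> exp (h * real (n + g))" using growth[of n F] F n by simp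
    finally show ?thesis by linarith
  qed
  moreover have "?P {undefined}" by (simp add: separated_def)
  ultimately have "\<exists>F. ?P F \<and> (\<forall>F'. ?P F' \<longrightarrow> card F' \<le> card F)"
    by (intro ex_has_greatest_nat[where b = "Suc (nat \<lceil>exp (h * real (n + g))\<rceil>)"]) (auto simp: less_Suc_eq_le)
  then obtain F where F: "separated n (\<epsilon> / 2) F" "F \<noteq> {}" and max: "\<And>F'. ?P F' \<Longrightarrow> card F' \<le> card F"
    by auto
  have finF: "finite F" by (rule separated_card_le(1)[OF F(1) e2])
  have "x \<in> \<Union>(bowen_ball n ` F)" for x
  proof (rule ccontr)
    assume x: "x \<notin> \<Union>(bowen_ball n ` F)"
    then have "x \<notin> F" using center_in_bowen_ball by blast
    have far: "\<exists>i<n. \<epsilon> / 2 \<le> d ((f ^^ i) c) ((f ^^ i) x)" if "c \<in> F" for c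
      using x that by (auto simp: bowen_ball_def not_less)
    then have far': "\<exists>i<n. \<epsilon> / 2 \<le> d ((f ^^ i) x) ((f ^^ i) c)" if "c \<in> F" for c
      using that by (subst dist_sym)
    have "separated n (\<epsilon> / 2) (insert x F)"
      using F(1) far far' unfolding separated_def by auto
    then have "card (insert x F) \<le> card F" using max by blast
    then show False using \<open>x \<notin> F\<close> finF by simp
  qed
  then have "coded n UNIV (\<lambda>_. ln (card (bowen_ball n ` F)))"
    using finF F(2) small_bowen_ball by (intro coded_family) auto
  moreover have "ln (card (bowen_ball n ` F)) \<le> h * real (n + g)"
  proof -
    have "0 < card (bowen_ball n ` F)" using finF F(2) by (simp add: card_gt_0_iff)
    moreover have "card (bowen_ball n ` F) \<le> card F" using finF by (rule card_image_le)
    ultimately have "ln (real (card (bowen_ball n ` F))) \<le> ln (real (card F))"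
      by (intro ln_mono) simp_all
    also have "\<dots> \<le> h * real (n + g)" by (rule growth[OF F(1) n F(2)])
    finally show ?thesis .
  qed
  ultimately show ?thesis by (auto intro: coded_mono)
qed

text \<open>
  Cut an orbit into \<open>K\<close> blocks of length \<open>n\<close>. Each visit to the small set \<open>A\<close> costs nothing
  beyond its position, while the stretch between consecutive visits is coded by a spanning set.
\<close>

lemma coded_visits:
  assumes A: "small n A" and t: "0 < t" "t < 1"
    and spanning: "\<And>m. coded m UNIV (\<lambda>_. h * real (m + g))"
  shows "coded (K * n) UNIV
    (\<lambda>x. (\<Sum>j<K. if (f ^^ (j * n)) x \<in> A then h * g - ln t else h * n - ln (1 - t)) + h * g)"
\<comment> \<open>Induction on the first visit: if it happens in block \<open>l\<close>, then
  \<open>K - l - 1\<close> blocks remain.\<close>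
proof (induction K rule: less_induct)
  case (less K)
  define \<phi> where "\<phi> y = (if y \<in> A then h * g - ln t else h * n - ln (1 - t))" for y
  define \<Phi> where "\<Phi> K x = (\<Sum>j<K. \<phi> ((f ^^ (j * n)) x)) + h * g" for K x
  have IH: "coded (K' * n) UNIV (\<Phi> K')" if "K' < K" for K'
    using less.IH[OF that] unfolding \<Phi>_def \<phi>_def .
  \<comment> \<open>The distribution of the waiting time for the first success in \<open>K\<close>
    Bernoulli trials; \<open>l = K\<close> stands for no success.\<close>
  define w where "w l = (if l < K then (1 - t) ^ l * t else (1 - t) ^ K)" for l
  define D where "D l = (if l < K then (f ^^ (l * n)) -` A else UNIV)" for l
  \<comment> \<open>A spanning set up to the first visit, \<open>A\<close> itself for the block of
    the visit, then the code for the remaining blocks. The overhead \<open>h * g\<close> of the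
    stretch before a visit is charged to that visit, that of the final stretch to the constant in
    \<open>\<Phi>\<close>.\<close>
  define \<Psi> where "\<Psi> l x = (if l < K then h * real (l * n + g) + \<Phi> (K - l - 1) ((f ^^ n) ((f ^^ (l * n)) x))
    else h * real (K * n + g))" for l x
  have A_coded: "coded n A (\<lambda>_. 0)" using coded_family[of "{A}" n A] A by simp
  have "coded (K * n) UNIV (\<Phi> K)"
  proof (rule coded_mix[where I = "{..K}" and D = D and \<Psi> = \<Psi> and t = w])
    show "w l > 0" for l using t by (simp add: w_def)
    have "(\<Sum>l<K. (1 - t) ^ l * t) + (1 - t) ^ K = 1"
      by (induction K) (simp_all add: algebra_simps)
    then show "(\<Sum>l\<le>K. w l) \<le> 1"
      by (simp add: w_def lessThan_Suc_atMost[symmetric])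
    show "coded (K * n) (D l) (\<Psi> l)" if "l \<in> {..K}" for l
    proof (cases "l < K")
      case True
      then have "coded ((K - l - 1) * n) UNIV (\<Phi> (K - l - 1))" by (intro IH) auto
      from coded_concat[OF spanning[of "l * n"] coded_concat[OF A_coded this]]
      have "coded (l * n + (n + (K - l - 1) * n)) ((f ^^ (l * n)) -` A)
        (\<lambda>x. h * real (l * n + g) + \<Phi> (K - l - 1) ((f ^^ n) ((f ^^ (l * n)) x)))"
        by simp
      moreover have "l * n + (n + (K - l - 1) * n) = (l + (1 + (K - l - 1))) * n"
        by (simp only: add_mult_distrib mult_1)
      moreover have "l + (1 + (K - l - 1)) = K" using True by simp
      ultimately show ?thesis using True by (simp add: D_def \<Psi>_def[abs_def])
    next
      case False
      then show ?thesis using spanning[of "K * n"] that by (simp add: D_def \<Psi>_def[abs_def])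
    qed
    show "\<exists>l\<in>{..K}. x \<in> D l \<and> \<Psi> l x - ln (w l) \<le> \<Phi> K x" for x
    proof (cases "\<exists>l<K. (f ^^ (l * n)) x \<in> A")
      case False
      then have "(\<Sum>j<K. \<phi> ((f ^^ (j * n)) x)) = (\<Sum>j<K. h * n - ln (1 - t))"
        by (intro sum.cong) (auto simp: \<phi>_def)
      then have "\<Psi> K x - ln (w K) = \<Phi> K x"
        using t by (simp add: \<Psi>_def \<Phi>_def w_def ln_realpow algebra_simps)
      then show ?thesis by (intro bexI[of _ K]) (auto simp: D_def)
    next
      case True
      define l where "l = (LEAST l. l < K \<and> (f ^^ (l * n)) x \<in> A)"
      have l: "l < K" "(f ^^ (l * n)) x \<in> A"
        using LeastI_ex[OF True] unfolding l_def by auto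
      have before: "(f ^^ (j * n)) x \<notin> A" if "j < l" for j
        using not_less_Least[of j "\<lambda>l. l < K \<and> (f ^^ (l * n)) x \<in> A"] that l(1) unfolding l_def by auto
      define r where "r = K - l - 1"
      have K: "K = l + Suc r" using l(1) by (simp add: r_def)
      have shift: "(f ^^ ((l + Suc j) * n)) x = (f ^^ (j * n)) ((f ^^ n) ((f ^^ (l * n)) x))" for j
      proof -
        have "(l + Suc j) * n = j * n + (n + l * n)" by (simp add: algebra_simps)
        then show ?thesis by (simp only: funpow_add comp_apply)
      qed
      have "(\<Sum>j<K. \<phi> ((f ^^ (j * n)) x)) = (\<Sum>j<l. \<phi> ((f ^^ (j * n)) x)) +
          (\<phi> ((f ^^ (l * n)) x) + (\<Sum>j<r. \<phi> ((f ^^ ((l + Suc j) * n)) x)))"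
        unfolding K sum_lessThan_add sum.lessThan_Suc_shift by simp
      also have "(\<Sum>j<l. \<phi> ((f ^^ (j * n)) x)) = (\<Sum>j<l. h * n - ln (1 - t))"
        using before by (intro sum.cong) (auto simp: \<phi>_def)
      also have "\<phi> ((f ^^ (l * n)) x) = h * g - ln t" using l(2) by (simp add: \<phi>_def)
      also have "(\<Sum>j<r. \<phi> ((f ^^ ((l + Suc j) * n)) x)) =
          (\<Sum>j<r. \<phi> ((f ^^ (j * n)) ((f ^^ n) ((f ^^ (l * n)) x))))" by (simp only: shift)
      finally have "\<Phi> K x = l * (h * n - ln (1 - t)) + (h * g - ln t) + \<Phi> r ((f ^^ n) ((f ^^ (l * n)) x))"
        by (simp add: \<Phi>_def)
      moreover have "ln (w l) = l * ln (1 - t) + ln t"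
        using l(1) t by (simp add: w_def ln_mult ln_realpow)
      ultimately have "\<Psi> l x - ln (w l) = \<Phi> K x"
        using l(1) by (simp add: \<Psi>_def r_def algebra_simps)
      then show ?thesis using l by (intro bexI[of _ l]) (auto simp: D_def)
    qed
  qed simp
  then show ?case unfolding \<Phi>_def[abs_def] \<phi>_def .
qed

end

context invariant_measure
begin

text \<open>One sequence of codes bounds the entropy of every finite measurable partition: the
  constant \<open>B\<close> depends on the partition and on \<open>\<theta>\<close> but not on
  \<open>n\<close>, so it disappears on division by \<open>n\<close>.\<close>

lemma metric_entropy_le_coded:
  assumes "\<And>n. coded n UNIV (\<Phi> n)" "\<And>n. integrable M (\<Phi> n)"
    and bound: "\<And>n. (\<integral>x. \<Phi> n x \<partial>M) \<le> real n * c + b"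
  shows "metric_entropy M f \<le> ereal c"
  unfolding metric_entropy_def
proof (rule SUP_least, clarify)
  fix \<alpha> assume \<alpha>: "finite \<alpha>" "\<alpha> \<subseteq> sets M" "partition_on (space M) \<alpha>"
  show "limsup (\<lambda>n. ereal (partition_entropy M (dyn_join f \<alpha> n) / real n)) \<le> ereal c"
  proof (rule ereal_le_epsilon2)
    fix \<theta> :: real assume \<theta>: "0 < \<theta>"
    obtain B where B: "\<And>n \<Phi>. coded n UNIV \<Phi> \<Longrightarrow> integrable M \<Phi> \<Longrightarrow>
      partition_entropy M (dyn_join f \<alpha> n) \<le> (\<integral>x. \<Phi> x \<partial>M) + real n * \<theta> + B"
      using entropy_le_coded[OF \<alpha> \<theta>] by blast
    have "partition_entropy M (dyn_join f \<alpha> n) / real n \<le> (c + \<theta>) + (b + B) / real n" if "n \<ge> 1" for n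
    proof -
      have "partition_entropy M (dyn_join f \<alpha> n) \<le> real n * (c + \<theta>) + (b + B)"
        using B[OF assms(1,2)[of n]] bound[of n] by (simp add: algebra_simps)
      then have "partition_entropy M (dyn_join f \<alpha> n) / real n \<le> (real n * (c + \<theta>) + (b + B)) / real n"
        by (rule divide_right_mono) simp
      then show ?thesis using that by (simp add: add_divide_distrib)
    qed
    then have "limsup (\<lambda>n. ereal (partition_entropy M (dyn_join f \<alpha> n) / real n)) \<le>
      limsup (\<lambda>n. ereal ((c + \<theta>) + (b + B) / real n))"
      by (intro Limsup_mono eventually_mono[OF eventually_ge_at_top[of 1]]) simp
    also have "(\<lambda>n. (c + \<theta>) + (b + B) / real n) \<longlonglongrightarrow> (c + \<theta>) + 0"
      by (intro tendsto_intros lim_const_over_n)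
    then have "limsup (\<lambda>n. ereal ((c + \<theta>) + (b + B) / real n)) = ereal (c + \<theta>)"
      by (intro lim_imp_Limsup) auto
    finally show "limsup (\<lambda>n. ereal (partition_entropy M (dyn_join f \<alpha> n) / real n)) \<le> ereal c + ereal \<theta>"
      by simp
  qed
qed

lemma metric_entropy_finite: "metric_entropy M f < \<infinity>"
proof -
  obtain c :: real where "\<And>n. coded n UNIV (\<lambda>_. real n * c)" using coded_linear by blast
  then have "metric_entropy M f \<le> ereal c"
    by (rule metric_entropy_le_coded[where b = 0]) (simp_all add: prob_space)
  then show ?thesis by (rule order_le_less_trans) simp
qed

lemma measure_bowen_ball_le:
  assumes h: "h \<ge> 0" "metric_entropy M f = ereal h" and n: "n \<ge> 1"
    and spanning: "\<And>m. coded m UNIV (\<lambda>_. h * real (m + g))"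
  shows "measure M (bowen_ball n x) \<le> 2 * exp (1 + h * g) * exp (- (h * n))"
proof (cases "measure M (bowen_ball n x) = 0")
  case False
  define A where "A = bowen_ball n x"
  define p where "p = measure M A"
  have p: "0 < p" "p \<le> 1" using False by (auto simp: p_def A_def zero_less_measure_iff)
  \<comment> \<open>Halving keeps \<open>t < 1\<close> even when \<open>p = 1\<close>.\<close>
  define t where "t = p / 2"
  have t: "0 < t" "t < 1" using p by (auto simp: t_def)
  define c\<^sub>1 where "c\<^sub>1 = h * g - ln t"
  define c\<^sub>2 where "c\<^sub>2 = h * n - ln (1 - t)"
  define Q where "Q = p * c\<^sub>1 + (1 - p) * c\<^sub>2"
  have c: "c\<^sub>1 \<ge> 0" "c\<^sub>2 \<ge> 0"
  proof -
    have "ln t \<le> 0" "ln (1 - t) \<le> 0" "0 \<le> h * g" "0 \<le> h * n" using t h(1) by simp_all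
    then show "c\<^sub>1 \<ge> 0" "c\<^sub>2 \<ge> 0" unfolding c\<^sub>1_def c\<^sub>2_def by linarith+
  qed
  have Q: "Q \<ge> 0" using c p by (simp add: Q_def)
  have A_sets: "A \<in> sets M" unfolding A_def using sets_M open_bowen_ball by simp
  \<comment> \<open>The cost from \<open>coded_visits\<close>, rewritten as an affine function of
    indicators so that \<open>integral_visits\<close> gives the mean cost \<open>Q\<close> per
    block.\<close>
  define \<Phi> where "\<Phi> K y = (\<Sum>j<K. c\<^sub>2 + (c\<^sub>1 - c\<^sub>2) * indicator A ((f ^^ (j * n)) y)) + h * g" for K y
  have cod: "coded (K * n) UNIV (\<Phi> K)" for K
  proof -
    have "coded (K * n) UNIV (\<lambda>y. (\<Sum>j<K. if (f ^^ (j * n)) y \<in> A then c\<^sub>1 else c\<^sub>2) + h * g)"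
      unfolding c\<^sub>1_def c\<^sub>2_def A_def by (intro coded_visits small_bowen_ball t spanning)
    moreover have "(\<Sum>j<K. if (f ^^ (j * n)) y \<in> A then c\<^sub>1 else c\<^sub>2) + h * g = \<Phi> K y" for y
      unfolding \<Phi>_def by (intro arg_cong2[where f = "(+)"] sum.cong) (auto simp: indicator_def)
    ultimately show ?thesis by simp
  qed
  have int: "integrable M (\<Phi> K)" for K
    unfolding \<Phi>_def[abs_def]
    by (intro Bochner_Integration.integrable_add integrable_visits A_sets integrable_const)
  have integral: "(\<integral>y. \<Phi> K y \<partial>M) = K * Q + h * g" for K
    unfolding \<Phi>_def
      Bochner_Integration.integral_add[OF integrable_visits[OF A_sets] integrable_const] integral_visits[OF A_sets]
    by (simp add: prob_space p_def[symmetric] Q_def algebra_simps)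
  have "metric_entropy M f \<le> ereal (Q / n)"
  \<comment> \<open>An order \<open>N\<close> that is no multiple of \<open>n\<close> is rounded up
    to a whole number of blocks, at the price of at most one additional \<open>Q\<close>.\<close>
  proof (rule metric_entropy_le_coded[where \<Phi> = "\<lambda>N. \<Phi> (N div n + 1)" and b = "Q + h * g"])
    fix N
    have "N div n * n + N mod n = N" "N mod n < n" using n by auto
    then have "N \<le> (N div n + 1) * n" unfolding add_mult_distrib by linarith
    then show "coded N UNIV (\<Phi> (N div n + 1))" by (intro coded_mono[OF cod]) auto
    show "integrable M (\<Phi> (N div n + 1))" by (rule int)
    have "real (N div n) \<le> real N / real n" by (rule of_nat_div_le_of_nat)
    then have "real (N div n) * Q \<le> real N / real n * Q" using Q by (rule mult_right_mono)
    then show "(\<integral>y. \<Phi> (N div n + 1) y \<partial>M) \<le> real N * (Q / n) + (Q + h * g)"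
      unfolding integral by (simp add: algebra_simps)
  qed
  then have "h \<le> Q / n" using h(2) by simp
  then have hQ: "h * n \<le> Q" using n by (simp add: field_simps)
  \<comment> \<open>Here \<open>1 / (1 - t) - 1\<close> equals \<open>p / (2 - p)\<close>, which is
    at most \<open>p\<close>. In \<open>h * n \<le> Q\<close> only \<open>p * (h * n)\<close>
    survives cancellation, so dividing by \<open>p\<close> bounds \<open>ln t\<close>.\<close>
  have "- ln (1 - t) = ln (1 / (1 - t))" using t by (simp add: ln_div)
  also have "\<dots> \<le> 1 / (1 - t) - 1" using t by (intro ln_le_minus_one) simp
  also have "\<dots> \<le> p" using p unfolding t_def by (simp add: field_simps)
  finally have "(1 - p) * (- ln (1 - t)) \<le> (1 - p) * p" using p by (intro mult_left_mono) auto
  also have "\<dots> \<le> p" using p by (simp add: algebra_simps)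
  finally have "p * (h * n) \<le> p * (h * g - ln t + 1)"
    using hQ unfolding Q_def c\<^sub>1_def c\<^sub>2_def by (simp add: algebra_simps)
  then have "ln t \<le> 1 + h * g - h * n" using p by simp
  then have "exp (ln t) \<le> exp (1 + h * g - h * n)" by (simp only: exp_le_cancel_iff)
  then have "t \<le> exp (1 + h * g - h * n)" by (simp only: exp_ln t(1))
  then have "p \<le> 2 * exp (1 + h * g - h * n)" by (simp add: t_def)
  also have "exp (1 + h * g - h * n) = exp (1 + h * g) * exp (- (h * n))" by (simp add: exp_add[symmetric])
  finally show ?thesis by (simp add: p_def A_def)
qed simp

end

section \<open>Correlation integrals\<close>

context invariant_measure
begin

text \<open>Gives the measurability of the integrand of the correlation integral. Slightly smaller
  concentric balls exhaust the measure of the ball, and each of them is contained in the balls of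
  radius \<open>r\<close> about nearby centres.\<close>

lemma measure_ball_lower_semicontinuous: "open {x. a < measure M {y. d x y < r}}"
  unfolding open_iff_dist
proof
  fix x assume x: "x \<in> {x. a < measure M {y. d x y < r}}"
  let ?B = "\<lambda>n. {y. d x y < r - 1 / real (Suc n)}"
  have "(\<Union>n. ?B n) = {y. d x y < r}"
  proof (intro equalityI subsetI)
    fix y assume "y \<in> {y. d x y < r}"
    then have "0 < r - d x y" by simp
    then obtain n where "1 / real (Suc n) < r - d x y" using nat_approx_posE by blast
    then show "y \<in> (\<Union>n. ?B n)" by (intro UN_I[of n]) auto
  next
    fix y assume "y \<in> (\<Union>n. ?B n)"
    then obtain n where "d x y < r - 1 / real (Suc n)" by blast
    moreover have "0 < 1 / real (Suc n)" by simp
    ultimately show "y \<in> {y. d x y < r}" unfolding mem_Collect_eq by linarith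
  qed
  moreover have "(\<lambda>n. measure M (?B n)) \<longlonglongrightarrow> measure M (\<Union>n. ?B n)"
  proof (rule finite_Lim_measure_incseq)
    show "range ?B \<subseteq> sets M" using sets_M open_dist_less by auto
    show "incseq ?B"
    proof (rule incseq_SucI)
      fix n
      have "1 / real (Suc (Suc n)) \<le> 1 / real (Suc n)" by (simp add: field_simps)
      then show "?B n \<subseteq> ?B (Suc n)" unfolding Collect_mono_iff by (meson diff_left_mono order_less_le_trans)
    qed
  qed
  ultimately have "(\<lambda>n. measure M (?B n)) \<longlonglongrightarrow> measure M {y. d x y < r}" by simp
  then have "eventually (\<lambda>n. a < measure M (?B n)) sequentially"
    by (rule order_tendstoD(1)) (use x in simp)
  then obtain n where n: "a < measure M (?B n)" by (auto simp: eventually_sequentially)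
  have "a < measure M {z. d y z < r}" if y: "d x y < 1 / real (Suc n)" for y
  proof -
    have "?B n \<subseteq> {z. d y z < r}"
    proof
      fix z assume "z \<in> ?B n"
      then show "z \<in> {z. d y z < r}"
        using y dist_triangle[of y z x] dist_sym[of x y] by simp
    qed
    then have "measure M (?B n) \<le> measure M {z. d y z < r}"
      by (rule finite_measure_mono) (use sets_M open_dist_less in simp)
    with n show ?thesis by simp
  qed
  then show "\<exists>s>0. \<forall>y. d x y < s \<longrightarrow> y \<in> {x. a < measure M {y. d x y < r}}"
    by (intro exI[of _ "1 / real (Suc n)"]) simp
qed

lemma measurable_measure_ball: "(\<lambda>x. measure M {y. d x y < r}) \<in> borel_measurable M"
  unfolding borel_measurable_iff_greater using sets_M measure_ball_lower_semicontinuous by simp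

text \<open>The complement of the support is a possibly uncountable union of null open sets. Its
  closed subsets are compact, hence covered by finitely many of these sets and null; inner
  approximation does the rest.\<close>

lemma
  shows support_sets: "topological_support M \<in> sets M"
    and measure_support: "measure M (topological_support M) = 1"
proof -
  define N where "N = \<Union>{U. open U \<and> measure M U = 0}"
  have "topological_support M = - N"
    unfolding topological_support_def N_def by (auto simp: zero_less_measure_iff)
  moreover have "open N" unfolding N_def by auto
  then have N_sets: "N \<in> sets M" using sets_M by simp
  have "measure M N \<le> 0 + e" if e: "e > 0" for e
  proof -
    have "N \<in> sets borel" using N_sets sets_M by simp
    from closed_open_approximation[OF finite_measure_axioms sets_M this, rule_format, OF e]
    obtain F U where FU: "closed F" "open U" "F \<subseteq> N" "N \<subseteq> U" "measure M (U - F) < e" by auto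
    have F_sets: "F \<in> sets M" "U \<in> sets M" using FU sets_M by auto
    have "compact F" using compact_Int_closed[OF compact_UNIV FU(1)] by simp
    then obtain \<V> where \<V>: "\<V> \<subseteq> {U. open U \<and> measure M U = 0}" "finite \<V>" "F \<subseteq> \<Union>\<V>"
      using FU(3) unfolding N_def by (rule compactE) auto
    have "measure M F \<le> measure M (\<Union>V\<in>\<V>. V)"
      using \<V> sets_M by (intro finite_measure_mono sets.finite_UN) auto
    also have "\<dots> \<le> (\<Sum>V\<in>\<V>. measure M V)"
      using \<V> sets_M by (intro finite_measure_subadditive_finite) auto
    also have "\<dots> = 0" using \<V>(1) by (intro sum.neutral) auto
    finally have "measure M F \<le> 0" .
    moreover have "measure M N \<le> measure M (F \<union> (U - F))"
      using FU F_sets by (intro finite_measure_mono) auto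
    moreover have "\<dots> \<le> measure M F + measure M (U - F)"
      using F_sets by (intro measure_Un_le) auto
    ultimately show ?thesis using FU(5) by linarith
  qed
  then have "measure M N \<le> 0" by (rule field_le_epsilon)
  then have "measure M N = 0" by (simp add: measure_le_0_iff)
  ultimately show "topological_support M \<in> sets M" "measure M (topological_support M) = 1"
    using N_sets prob_compl[OF N_sets] sets.compl_sets[OF N_sets] by (simp_all add: Compl_eq_Diff_UNIV)
qed

text \<open>Positivity is what allows the logarithm to be taken monotonically: the integrand is
  positive on the support, which has full measure.\<close>

lemma
  assumes q: "q > 1" and r: "r > 0"
    and bound: "\<And>x. measure M {y. d x y < r} \<le> B"
  defines "I \<equiv> (LINT x:topological_support M|M. measure M {y. d x y < r} powr (q - 1))"
  shows correlation_integral_pos: "0 < I"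
    and correlation_integral_le: "I \<le> B powr (q - 1)"
proof -
  let ?S = "topological_support M"
  define G where "G x = indicator ?S x * measure M {y. d x y < r} powr (q - 1)" for x
  have I: "I = (\<integral>x. G x \<partial>M)"
    unfolding I_def G_def set_lebesgue_integral_def by simp
  have G_meas: "G \<in> borel_measurable M"
    unfolding G_def[abs_def] using measurable_measure_ball support_sets by measurable
  have G_nonneg: "0 \<le> G x" for x by (simp add: G_def)
  have G_le: "G x \<le> B powr (q - 1)" for x
    using bound[of x] q by (auto simp: G_def indicator_def intro: powr_mono2)
  have G_int: "integrable M G"
    by (rule integrable_const_bound[where B = "B powr (q - 1)"]) (use G_nonneg G_le G_meas in auto)
  have "I \<le> (\<integral>x. B powr (q - 1) \<partial>M)"
    unfolding I using G_int G_le by (intro integral_mono) auto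
  then show "I \<le> B powr (q - 1)" by simp
  have "I \<noteq> 0"
  proof
    assume "I = 0"
    then have "AE x in M. G x = 0"
      unfolding I using integral_nonneg_eq_0_iff_AE[OF G_int] G_nonneg by simp
    moreover have "G x \<noteq> 0" if x: "x \<in> ?S" for x
    proof -
      have "open {y. d x y < r}" "x \<in> {y. d x y < r}" using open_dist_less r by auto
      then have "measure M {y. d x y < r} > 0" using x unfolding topological_support_def by blast
      then show ?thesis using x by (simp add: G_def)
    qed
    ultimately have "AE x in M. x \<notin> ?S" by (auto elim: AE_mp)
    then have "measure M ?S = 0"
      using support_sets by (subst (asm) AE_iff_measurable[OF support_sets]) (auto simp: measure_def)
    then show False using measure_support by simp
  qed
  moreover have "0 \<le> I" unfolding I using G_nonneg by (intro integral_nonneg_AE) auto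
  ultimately show "0 < I" by simp
qed

end

section \<open>Lipschitz scaling and the dimension bound\<close>

lemma (in compact_metric) lipschitz_constant_is_lipschitz:
  assumes "is_lipschitz_constant d f L"
  shows "d (f x) (f y) \<le> lipschitz_constant d f * d x y"
proof (cases "x = y")
  case False
  then have xy: "d x y > 0" using dist_nonneg[of x y] dist_zero_iff[of x y] by linarith
  \<comment> \<open>Every Lipschitz constant is an upper bound of this quotient, hence so is their
    infimum.\<close>
  have "d (f x) (f y) / d x y \<le> lipschitz_constant d f"
    unfolding lipschitz_constant_def
  proof (rule cInf_greatest)
    show "{L. is_lipschitz_constant d f L} \<noteq> {}" using assms by blast
    show "d (f x) (f y) / d x y \<le> L" if "L \<in> {L. is_lipschitz_constant d f L}" for L
      using that xy by (simp add: is_lipschitz_constant_def pos_divide_le_eq)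
  qed
  then show ?thesis using xy by (simp add: pos_divide_le_eq)
qed simp

text \<open>Comparison with Bowen balls bounds the measure of a ball of radius \<open>r\<close> by a
  constant times \<open>r powr D\<close>, where \<open>D\<close> is the entropy divided by
  \<open>ln \<Lambda>\<close>; the correlation integral inherits this exponent.\<close>

lemma (in invariant_measure) dimension_bound:
  assumes max_entropy: "metric_entropy M f = topological_entropy f"
    and spec_f: "specification_property f"
    and lipschitz: "\<And>x y. d (f x) (f y) \<le> \<Lambda> * d x y" and \<Lambda>: "\<Lambda> > 1" and q: "q > 1"
  shows "topological_entropy f / ereal (ln \<Lambda>) \<le> lower_fractal_dim d M q"
proof -
  have e2: "\<epsilon> / 2 > 0" using \<epsilon> by simp
  obtain g where growth: "\<And>n F. separated n (\<epsilon> / 2) F \<Longrightarrow> n \<ge> 1 \<Longrightarrow> F \<noteq> {} \<Longrightarrow>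
       ereal (ln (card F) / real (n + g)) \<le> topological_entropy f"
    using separated_growth[OF spec_f e2] by blast
  \<comment> \<open>A singleton is separated and has \<open>ln 1 = 0\<close>. Finiteness is
    inherited from the metric entropy through maximality.\<close>
  have "0 \<le> topological_entropy f"
    using growth[of 1 "{undefined}"] by (simp add: separated_def zero_ereal_def)
  moreover have "topological_entropy f < \<infinity>" using metric_entropy_finite max_entropy by simp
  ultimately obtain h where h: "topological_entropy f = ereal h" "h \<ge> 0"
    by (cases "topological_entropy f") auto
  have "ln (card F) \<le> h * real (n + g)" if "separated n (\<epsilon> / 2) F" "n \<ge> 1" "F \<noteq> {}" for n F
  proof -
    have "ln (card F) / real (n + g) \<le> h" using growth[OF that] h(1) by simp
    then show ?thesis using that(2) by (simp add: pos_divide_le_eq)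
  qed
  then have spanning: "coded m UNIV (\<lambda>_. h * real (m + g))" for m
    by (intro coded_spanning[OF h(2)]) auto
  have bowen: "measure M (bowen_ball n x) \<le> 2 * exp (1 + h * g) * exp (- (h * n))" if "n \<ge> 1" for n x
    using h max_entropy that spanning by (intro measure_bowen_ball_le) auto
  define \<sigma> where "\<sigma> = ln \<Lambda>"
  have \<sigma>: "\<sigma> > 0" using \<Lambda> by (simp add: \<sigma>_def)
  define D where "D = h / \<sigma>"
  define c where "c = ln 2 + 1 + h * g - D * ln (\<epsilon> / 2)"
  have iterate: "d ((f ^^ i) x) ((f ^^ i) y) \<le> \<Lambda> ^ i * d x y" for i x y
  proof (induction i)
    case (Suc i)
    have "d ((f ^^ Suc i) x) ((f ^^ Suc i) y) \<le> \<Lambda> * d ((f ^^ i) x) ((f ^^ i) y)"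
      using lipschitz by simp
    also have "\<dots> \<le> \<Lambda> * (\<Lambda> ^ i * d x y)" using Suc \<Lambda> by (intro mult_left_mono) auto
    finally show ?case by (simp add: mult.assoc)
  qed simp
  have ball: "measure M {y. d x y < r} \<le> exp (c + D * ln r)" if r: "0 < r" "r < \<epsilon> / 2" for r x
  proof -
    \<comment> \<open>\<open>a\<close> is the real solution of
      \<open>\<Lambda> powr a * r = \<epsilon> / 2\<close>. Rounding down keeps the iterates up to
      time \<open>n\<close> within \<open>\<epsilon> / 2\<close>, while the order
      \<open>n + 1\<close> of the Bowen ball is still at least \<open>a\<close>.\<close>
    define a where "a = (ln (\<epsilon> / 2) - ln r) / \<sigma>"
    define n where "n = nat \<lfloor>a\<rfloor>"
    have "a \<ge> 0" unfolding a_def using r \<sigma> by (intro divide_nonneg_pos) auto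
    then have n: "real n \<le> a" "a \<le> real (n + 1)" unfolding n_def by linarith+
    have "\<Lambda> ^ n = exp (real n * \<sigma>)" using \<Lambda> by (simp add: \<sigma>_def exp_of_nat_mult)
    also have "\<dots> \<le> exp (a * \<sigma>)" using n(1) \<sigma> by simp
    also have "\<dots> = \<epsilon> / 2 / r" using \<sigma> r e2 by (simp add: a_def exp_diff)
    finally have scale: "\<Lambda> ^ n * r \<le> \<epsilon> / 2" using r(1) by (simp add: pos_le_divide_eq)
    have "{y. d x y < r} \<subseteq> bowen_ball (n + 1) x"
    proof
      fix y assume "y \<in> {y. d x y < r}"
      then have y: "d x y < r" by simp
      have "d ((f ^^ i) x) ((f ^^ i) y) < \<epsilon> / 2" if "i < n + 1" for i
      proof -
        have "d ((f ^^ i) x) ((f ^^ i) y) \<le> \<Lambda> ^ i * d x y" by (rule iterate)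
        also have "\<dots> < \<Lambda> ^ i * r" using y \<Lambda> by (intro mult_strict_left_mono) auto
        also have "\<dots> \<le> \<Lambda> ^ n * r" using that \<Lambda> r(1) by (intro mult_right_mono power_increasing) auto
        finally show ?thesis using scale by simp
      qed
      then show "y \<in> bowen_ball (n + 1) x" by (simp add: bowen_ball_def)
    qed
    then have "measure M {y. d x y < r} \<le> measure M (bowen_ball (n + 1) x)"
      using sets_M open_bowen_ball by (intro finite_measure_mono) auto
    also have "\<dots> \<le> 2 * exp (1 + h * g) * exp (- (h * real (n + 1)))" by (rule bowen) simp
    also have "\<dots> \<le> 2 * exp (1 + h * g) * exp (- (h * a))"
      using mult_left_mono[OF n(2) h(2)] by (intro mult_left_mono) auto
    also have "\<dots> = exp (ln 2 + (1 + h * g) + - (h * a))" by (simp only: exp_add exp_ln zero_less_numeral)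
    also have "ln 2 + (1 + h * g) + - (h * a) = c + D * ln r"
      unfolding c_def D_def a_def using \<sigma> by (simp add: field_simps)
    finally show ?thesis .
  qed
  define I where "I r = (LINT x:topological_support M|M. measure M {y. d x y < r} powr (q - 1))" for r
  have quotient: "c / ln r + D \<le> ln (I r) / ((q - 1) * ln r)" if r: "0 < r" "r < min 1 (\<epsilon> / 2)" for r
  proof -
    have ball': "measure M {y. d x y < r} \<le> exp (c + D * ln r)" for x using ball r by simp
    have pos: "0 < I r" and le: "I r \<le> exp (c + D * ln r) powr (q - 1)"
      unfolding I_def using correlation_integral_pos[OF q r(1) ball'] correlation_integral_le[OF q r(1) ball'] by auto
    have "ln (I r) \<le> ln (exp (c + D * ln r) powr (q - 1))" using le pos by (rule ln_mono)
    also have "\<dots> = (q - 1) * (c + D * ln r)" by (simp add: ln_powr)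
    finally have *: "ln (I r) \<le> (q - 1) * (c + D * ln r)" .
    have lnr: "ln r < 0" using r by simp
    then have neg: "(q - 1) * ln r < 0" using q by (simp add: mult_pos_neg)
    have "c / ln r + D = (q - 1) * (c + D * ln r) / ((q - 1) * ln r)"
      using lnr q by (simp add: field_simps)
    \<comment> \<open>Dividing by a negative number turns the upper bound on the integral into a
      lower bound on the quotient. The constant \<open>c\<close> is lost in the limit because
      \<open>ln r\<close> tends to minus infinity.\<close>
    also have "\<dots> \<le> ln (I r) / ((q - 1) * ln r)" using * neg by (intro divide_right_mono_neg) auto
    finally show ?thesis .
  qed
  have "((\<lambda>r. c / ln r + D) \<longlongrightarrow> 0 + D) (at_right 0)"
    by (intro tendsto_add tendsto_const tendsto_divide_0[OF tendsto_const]
        filterlim_at_bot_imp_at_infinity ln_at_0)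
  then have "Liminf (at_right 0) (\<lambda>r. ereal (c / ln r + D)) = ereal D"
    by (intro lim_imp_Liminf) auto
  moreover have "Liminf (at_right 0) (\<lambda>r. ereal (c / ln r + D)) \<le>
      Liminf (at_right 0) (\<lambda>r. ereal (ln (I r) / ((q - 1) * ln r)))"
  proof (rule Liminf_mono)
    have "eventually (\<lambda>r. r \<in> {0<..<min 1 (\<epsilon> / 2)}) (at_right 0)"
      using e2 by (intro eventually_at_right_real) simp
    then show "eventually (\<lambda>r. ereal (c / ln r + D) \<le> ereal (ln (I r) / ((q - 1) * ln r))) (at_right 0)"
      by (rule eventually_mono) (use quotient in auto)
  qed
  ultimately show ?thesis
    using h(1) \<sigma> by (simp add: lower_fractal_dim_def mball_eq I_def D_def \<sigma>_def)
qed

theorem corollary1p4: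
  fixes f :: "'a::topological_space \<Rightarrow> 'a"
    and \<mu> :: "'a measure"
    and d :: "'a \<Rightarrow> 'a \<Rightarrow> real"
    and \<Lambda> q :: real
  assumes "compact (UNIV :: 'a set)"
    and "metrizable_space (euclidean :: 'a topology)"
    and "homeomorphism UNIV UNIV f (inv f)"
    and "expansive f"
    and "specification_property f"
    and "invariant_borel_prob f \<mu>"
    and "metric_entropy \<mu> f = topological_entropy f"
    and "hyperbolic_metric f d"
    and "\<Lambda> = lipschitz_constant d f"
    and "\<Lambda> > 1"
    and "q > 1"
  shows "topological_entropy f / ereal (ln \<Lambda>) \<le> lower_fractal_dim d \<mu> q"
proof -
  obtain k \<epsilon> L where k: "k > 1" "\<epsilon> > 0"
      "\<And>x y. max (d (f x) (f y)) (d (inv f x) (inv f y)) \<ge> min (k * d x y) \<epsilon>"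
    and d: "compatible_metric d" "is_lipschitz_constant d f L"
    using assms(8) unfolding hyperbolic_metric_def by blast
  interpret invariant_measure d f k \<epsilon> \<mu>
    by unfold_locales (fact assms k d)+
  show ?thesis
    using lipschitz_constant_is_lipschitz[OF d(2)] assms by (intro dimension_bound) auto
qed

end
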